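(* Among all permuton processes $X$ with the property that $X(1) = -X(0)$ (almost surely), the Archimedean process $\mathcal{A}$ uniquely minimizes the energy. That is, every such $X$ satisfies $\mathcal{E}[X] \ge \mathcal{E}[\mathcal{A}]$, with equality if and only if $X$ has the same law as $\mathcal{A}$.
   Context: A permuton process is a $[-1,1]$-valued stochastic process $X=(X(t),0\le t\le 1)$ with continuous sample paths such that $X(t)$ has the uniform distribution on $[-1,1]$ for every $t\in[0,1]$. Processes are identified when they have the same law. The (Dirichlet) energy of a stochastic process $X=(X(t);0\le t\le 1)$ is $$\mathcal{E}[X] = \sup_{\Pi} \sum_{i=1}^k \frac{\mathbb{E}\left[|X(t_i)-X(t_{i-1})|^2\right]}{t_i-t_{i-1}},$$ where the supremum is over all finite partitions $\Pi = \{0=t_0<t_1<\cdots<t_k=1\}$ of $[0,1]$. The Archimedean measure is the unique probability measure on the plane all of whose projections onto lines through the origin have the uniform distribution on $[-1,1]$; it has density $\left(2\pi\sqrt{1-x^2-y^2}\right)^{-1}dx\,dy$ on the unit disk. Let $(\mathbf{A}_x,\mathbf{A}_y)$ be a random vector distributed according to the Archimedean measure. The Archimedean process is the permuton process $\mathcal{A}(t) = \cos(\pi t)\,\mathbf{A}_x + \sin(\pi t)\,\mathbf{A}_y$, $0\le t\le 1$. *)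

theory Defs
  imports "HOL-Probability.Probability"
begin

text \<open>
  A real-valued process with time set \<open>[0,1]\<close> on a probability space \<open>M\<close> is a function
  \<open>X :: real \<Rightarrow> 'a \<Rightarrow> real\<close>; only the values \<open>X t\<close> with \<open>0 \<le> t \<le> 1\<close> matter.  Since processes are
  identified when they have the same law, path properties are required almost surely.
\<close>

definition permuton_process :: "'a measure \<Rightarrow> (real \<Rightarrow> 'a \<Rightarrow> real) \<Rightarrow> bool" where
  "permuton_process M X \<longleftrightarrow>
     prob_space M \<and>
     (\<forall>t\<in>{0..1}. X t \<in> borel_measurable M) \<and>
     (AE \<omega> in M. continuous_on {0..1} (\<lambda>t. X t \<omega>) \<and> (\<forall>t\<in>{0..1}. X t \<omega> \<in> {-1..1})) \<and>
     (\<forall>t\<in>{0..1}. distr M borel (X t) = uniform_measure lborel {-1..1})"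

text \<open>
  The law is taken on the product sigma-algebra over the time set \<open>[0,1]\<close>.  On continuous paths this
  induces the Borel sigma-algebra of the uniform topology, so nothing is lost.
\<close>

definition process_law :: "'a measure \<Rightarrow> (real \<Rightarrow> 'a \<Rightarrow> real) \<Rightarrow> (real \<Rightarrow> real) measure" where
  "process_law M X =
     distr M (\<Pi>\<^sub>M t\<in>{0..1}. borel) (\<lambda>\<omega>. \<lambda>t\<in>{0..1}. X t \<omega>)"

text \<open>A partition \<open>0 = t\<^sub>0 < \<dots> < t\<^sub>k = 1\<close> is a pair \<open>(k, t)\<close>; values \<open>t i\<close> with \<open>i > k\<close> are irrelevant.\<close>

definition unit_partitions :: "(nat \<times> (nat \<Rightarrow> real)) set" where
  "unit_partitions = {(k, t). t 0 = 0 \<and> t k = 1 \<and> (\<forall>i<k. t i < t (Suc i))}"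

definition energy :: "'a measure \<Rightarrow> (real \<Rightarrow> 'a \<Rightarrow> real) \<Rightarrow> ennreal" where
  "energy M X =
     (SUP (k, t) \<in> unit_partitions.
        \<Sum>i<k. (\<integral>\<^sup>+ \<omega>. ennreal (\<bar>X (t (Suc i)) \<omega> - X (t i) \<omega>\<bar>\<^sup>2) \<partial>M) / ennreal (t (Suc i) - t i))"

definition archimedean_measure :: "(real \<times> real) measure" where
  "archimedean_measure =
     density lborel
       (\<lambda>(x, y). if x\<^sup>2 + y\<^sup>2 < 1 then ennreal (1 / (2 * pi * sqrt (1 - x\<^sup>2 - y\<^sup>2))) else 0)"

text \<open>
  The Archimedean process, realised on the canonical probability space
  \<open>archimedean_measure\<close>, where the identity is the random vector \<open>(A\<^sub>x, A\<^sub>y)\<close>.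
\<close>

definition archimedean_process :: "real \<Rightarrow> real \<times> real \<Rightarrow> real" where
  "archimedean_process t = (\<lambda>(x, y). cos (pi * t) * x + sin (pi * t) * y)"

end

theory Submission
  imports Defs "HOL-Real_Asymp.Real_Asymp"
begin

text \<open>
  Sample an antiperiodic process at the points \<open>i / N\<close> and subtract from the discrete energy the
  multiple of \<open>\<Sum> X (i / N)\<^sup>2\<close> that occurs in the discrete Wirtinger inequality, whose expectation is
  known because all one-point marginals are uniform. The remaining quadratic form is subadditive under
  concatenation of intervals, since interpolating a middle point by a solution of \<open>u'' = - u\<close>
  completes a square. Cutting the period at \<open>0\<close>, \<open>t\<close>, \<open>1/2\<close> and \<open>1\<close>, it is
  therefore bounded below by \<open>(X t - cos (pi t) X 0 - sin (pi t) X (1/2))\<^sup>2\<close>. Letting the mesh tend to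
  \<open>0\<close> gives \<open>energy \<ge> pi\<^sup>2 / 3\<close> and, in the case of equality, that \<open>X t\<close> is a
  trigonometric combination of \<open>X 0\<close> and \<open>X (1/2)\<close>. All projections of \<open>(X 0, X (1/2))\<close> are then
  uniform up to scaling, so a Cramer-Wold argument identifies the law of this vector as the Archimedean measure.
\<close>

section \<open>Projections of the Archimedean measure\<close>

definition archimedean_density :: "real \<times> real \<Rightarrow> ennreal" where
  "archimedean_density =
     (\<lambda>(x, y). if x\<^sup>2 + y\<^sup>2 < 1 then ennreal (1 / (2 * pi * sqrt (1 - x\<^sup>2 - y\<^sup>2))) else 0)"

lemma has_field_derivative_arcsin_scaled:
  fixes r v :: real
  assumes "\<bar>v\<bar> < r"
  shows "((\<lambda>v. arcsin (v / r) / (2 * pi)) has_field_derivative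
           1 / (2 * pi * sqrt (r\<^sup>2 - v\<^sup>2))) (at v)"
proof -
  have r: "r > 0" using assms by linarith
  have b: "-1 < v / r" "v / r < 1" using assms r by (auto simp: field_simps)
  have "sqrt (1 - (v / r)\<^sup>2) = sqrt ((r\<^sup>2 - v\<^sup>2) / r\<^sup>2)"
    using r by (simp add: field_simps)
  also have "\<dots> = sqrt (r\<^sup>2 - v\<^sup>2) / r"
    using r by (simp add: real_sqrt_divide)
  finally have s: "sqrt (1 - (v / r)\<^sup>2) = sqrt (r\<^sup>2 - v\<^sup>2) / r" .
  have "((\<lambda>v. arcsin (v / r) / (2 * pi)) has_field_derivative
           inverse (sqrt (1 - (v / r)\<^sup>2)) * (1 / r) / (2 * pi)) (at v)"
    using b r by (auto intro!: derivative_eq_intros simp: field_simps)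
  moreover have "inverse (sqrt (1 - (v / r)\<^sup>2)) * (1 / r) / (2 * pi) = 1 / (2 * pi * sqrt (r\<^sup>2 - v\<^sup>2))"
    unfolding s using r by (simp add: field_simps)
  ultimately show ?thesis by simp
qed

text \<open>The antiderivative \<open>arcsin (v / r) / (2 * pi)\<close> rises from -1/4 to 1/4
  whatever \<open>r\<close> is; this independence of \<open>r\<close> is what makes the Archimedean
  projections uniform. The integrand is unbounded near both ends, hence the improper form of the
  fundamental theorem, with one-sided limits of the antiderivative.\<close>

lemma nn_integral_inverse_sqrt:
  fixes r :: real
  assumes r: "r > 0"
  shows "(\<integral>\<^sup>+v. ennreal (1 / (2 * pi * sqrt (r\<^sup>2 - v\<^sup>2))) * indicator {-r<..<r} v \<partial>lborel) = ennreal (1 / 2)"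
proof -
  define F where "F = (\<lambda>v. arcsin (v / r) / (2 * pi))"
  define f where "f = (\<lambda>v. 1 / (2 * pi * sqrt (r\<^sup>2 - v\<^sup>2)))"
  have sq: "r\<^sup>2 - v\<^sup>2 > 0" if "\<bar>v\<bar> < r" for v
    using that abs_le_square_iff[of r v] r by auto
  have F: "DERIV F x :> f x" if "ereal (-r) < ereal x" "ereal x < ereal r" for x
    unfolding F_def f_def using that by (intro has_field_derivative_arcsin_scaled) auto
  have f: "isCont f x" if "ereal (-r) < ereal x" "ereal x < ereal r" for x
    unfolding f_def using less_imp_neq[OF sq[of x]] that by (intro continuous_intros) auto
  have fnn: "f x \<ge> 0" if "\<bar>x\<bar> < r" for x
    unfolding f_def using sq[OF that] by simp
  have cont: "continuous_on {-r..r} F"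
    unfolding F_def using r by (intro continuous_intros) (auto simp: field_simps)
  have L1: "(F \<longlongrightarrow> F (-r)) (at_right (-r))"
    using continuous_on_Icc_at_rightD[OF cont] r by simp
  have L2: "(F \<longlongrightarrow> F r) (at_left r)"
    using continuous_on_Icc_at_leftD[OF cont] r by simp
  have nn: "AE x in lborel. ereal (-r) < ereal x \<longrightarrow> ereal x < ereal r \<longrightarrow> 0 \<le> f x"
    using fnn by auto
  have A: "((F \<circ> real_of_ereal) \<longlongrightarrow> F (-r)) (at_right (ereal (-r)))"
    using L1 by (simp only: ereal_tendsto_simps)
  have B: "((F \<circ> real_of_ereal) \<longlongrightarrow> F r) (at_left (ereal r))"
    using L2 by (simp only: ereal_tendsto_simps)
  have lt: "ereal (-r) < ereal r" using r by simp
  note FTC = interval_integral_FTC_nonneg[OF lt F f nn A B]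
  have val: "F r - F (-r) = 1 / 2"
    unfolding F_def using r by simp
  have i1: "integrable lborel (\<lambda>x. indicator {-r<..<r} x * f x)"
    using FTC(1) by (simp add: set_integrable_def)
  have i2: "(LINT x|lborel. indicator {-r<..<r} x * f x) = 1 / 2"
    using FTC(2) val r by (simp add: interval_lebesgue_integral_def set_lebesgue_integral_def)
  have "(\<integral>\<^sup>+v. ennreal (f v) * indicator {-r<..<r} v \<partial>lborel) = (\<integral>\<^sup>+v. ennreal (indicator {-r<..<r} v * f v) \<partial>lborel)"
    by (intro nn_integral_cong) (auto split: split_indicator)
  also have "\<dots> = ennreal (LINT x|lborel. indicator {-r<..<r} x * f x)"
    using fnn by (intro nn_integral_eq_integral i1) (auto split: split_indicator)
  also note i2
  finally show ?thesis unfolding f_def .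
qed

text \<open>The slice of the disk at abscissa \<open>u\<close> is an interval of half-length
  \<open>sqrt (1 - u^2)\<close>, and on it the density is the integrand of
  \<open>nn_integral_inverse_sqrt\<close> for that radius.\<close>

lemma nn_integral_archimedean_density_slice:
  "(\<integral>\<^sup>+v. archimedean_density (u, v) \<partial>lborel) = ennreal (1 / 2) * indicator {-1<..<1} u"
proof (cases "\<bar>u\<bar> < 1")
  case True
  define r where "r = sqrt (1 - u\<^sup>2)"
  have u: "u\<^sup>2 < 1" using True by (simp add: abs_square_less_1)
  have r: "r > 0" "r\<^sup>2 = 1 - u\<^sup>2" using u by (auto simp: r_def)
  have "(\<integral>\<^sup>+v. archimedean_density (u, v) \<partial>lborel)
      = (\<integral>\<^sup>+v. ennreal (1 / (2 * pi * sqrt (r\<^sup>2 - v\<^sup>2))) * indicator {-r<..<r} v \<partial>lborel)"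
  proof (intro nn_integral_cong)
    fix v :: real
    have "u\<^sup>2 + v\<^sup>2 < 1 \<longleftrightarrow> \<bar>v\<bar> < r"
      using r abs_le_square_iff[of r v] by auto
    then show "archimedean_density (u, v) = ennreal (1 / (2 * pi * sqrt (r\<^sup>2 - v\<^sup>2))) * indicator {-r<..<r} v"
      unfolding archimedean_density_def using r by (auto split: split_indicator)
  qed
  also have "\<dots> = ennreal (1 / 2)" using r by (intro nn_integral_inverse_sqrt)
  finally show ?thesis using True by (auto split: split_indicator)
next
  case False
  then have "u\<^sup>2 \<ge> 1" by (simp add: abs_square_less_1 not_less[symmetric])
  then have "\<not> u\<^sup>2 + v\<^sup>2 < 1" for v by (smt (verit) zero_le_power2)
  then show ?thesis using False by (auto simp: archimedean_density_def split: split_indicator)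
qed

lemma borel_measurable_archimedean_density [measurable]: "archimedean_density \<in> borel_measurable borel"
proof -
  have "archimedean_density = (\<lambda>p. if (fst p)\<^sup>2 + (snd p)\<^sup>2 < 1
      then ennreal (1 / (2 * pi * sqrt (1 - (fst p)\<^sup>2 - (snd p)\<^sup>2))) else 0)"
    by (auto simp: archimedean_density_def fun_eq_iff)
  also have "\<dots> \<in> borel_measurable borel"
    by (simp add: borel_prod[symmetric])
  finally show ?thesis .
qed

lemma borel_measurable_projection [measurable]:
  "(\<lambda>p. c * fst p + s * snd p) \<in> borel_measurable (borel :: (real \<times> real) measure)"
  by (simp add: borel_prod[symmetric])

lemma sets_archimedean_measure [measurable_cong, simp]: "sets archimedean_measure = sets borel"
  by (simp add: archimedean_measure_def)

lemma nn_integral_archimedean_measure: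
  assumes [measurable]: "f \<in> borel_measurable borel"
  shows "(\<integral>\<^sup>+p. f p \<partial>archimedean_measure) = (\<integral>\<^sup>+x. \<integral>\<^sup>+y. archimedean_density (x, y) * f (x, y) \<partial>lborel \<partial>lborel)"
proof -
  have [measurable]: "(\<lambda>p. archimedean_density p * f p) \<in> borel_measurable (lborel \<Otimes>\<^sub>M lborel)"
    by (simp add: lborel_prod)
  have "(\<integral>\<^sup>+p. f p \<partial>archimedean_measure) = (\<integral>\<^sup>+p. archimedean_density p * f p \<partial>lborel)"
    unfolding archimedean_measure_def archimedean_density_def[symmetric] by (subst nn_integral_density) auto
  also have "\<dots> = (\<integral>\<^sup>+x. \<integral>\<^sup>+y. archimedean_density (x, y) * f (x, y) \<partial>lborel \<partial>lborel)"
    unfolding lborel_prod[symmetric] by (subst lborel.nn_integral_fst[symmetric]) auto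
  finally show ?thesis .
qed

lemma nn_integral_uniform_symmetric:
  assumes [measurable]: "g \<in> borel_measurable borel"
  shows "(\<integral>\<^sup>+u. g u \<partial>uniform_measure lborel {-1..1::real})
       = (\<integral>\<^sup>+u. ennreal (1 / 2) * indicator {-1<..<1} u * g u \<partial>lborel)"
proof -
  have "(\<integral>\<^sup>+u. g u \<partial>uniform_measure lborel {-1..1::real}) = (\<integral>\<^sup>+u. g u * indicator {-1..1} u \<partial>lborel) / 2"
    by (subst nn_integral_uniform_measure) auto
  also have "\<dots> = (\<integral>\<^sup>+u. g u * indicator {-1..1} u / 2 \<partial>lborel)"
    by (rule nn_integral_divide[symmetric]) auto
  also have "\<dots> = (\<integral>\<^sup>+u. ennreal (1 / 2) * indicator {-1<..<1} u * g u \<partial>lborel)"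
  proof (rule nn_integral_cong_AE)
    \<comment> \<open>The closed and the open interval differ in the null points -1 and 1.\<close>
    show "AE u in lborel. g u * indicator {-1..1} u / 2 = ennreal (1 / 2) * indicator {-1<..<1} u * g u"
      using AE_lborel_singleton[of "-1"] AE_lborel_singleton[of 1]
      by eventually_elim (auto simp: divide_ennreal_def mult.commute split: split_indicator)
  qed
  finally show ?thesis .
qed

text \<open>The density depends on the norm only, so every unit vector \<open>(c, s)\<close> gives
  the same projection as the first axis, whose density is the constant slice mass 1/2.\<close>

lemma nn_integral_archimedean_projection:
  fixes c s :: real
  assumes cs: "c\<^sup>2 + s\<^sup>2 = 1" and [measurable]: "g \<in> borel_measurable borel"
  shows "(\<integral>\<^sup>+p. g (c * fst p + s * snd p) \<partial>archimedean_measure)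
       = (\<integral>\<^sup>+u. g u \<partial>uniform_measure lborel {-1..1})"
proof -
  have [measurable]: "archimedean_density \<in> borel_measurable (borel \<Otimes>\<^sub>M borel)"
    by (simp add: borel_prod)
  let ?J = "\<integral>\<^sup>+u. ennreal (1 / 2) * indicator {-1<..<1} u * g u \<partial>lborel"
  have start: "(\<integral>\<^sup>+p. g (c * fst p + s * snd p) \<partial>archimedean_measure)
      = (\<integral>\<^sup>+x. \<integral>\<^sup>+y. archimedean_density (x, y) * g (c * x + s * y) \<partial>lborel \<partial>lborel)" (is "?I = _")
    by (subst nn_integral_archimedean_measure) (auto simp: borel_prod[symmetric])
  have "?I = ?J"
  \<comment> \<open>For \<open>s = 0\<close> one cannot solve for \<open>y\<close>; the projection
    is then the first coordinate up to sign, and the uniform law is symmetric.\<close>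
  proof (cases "s = 0")
    case True
    then have c: "c = 1 \<or> c = -1" using cs by (simp add: power2_eq_1_iff)
    have "?I = (\<integral>\<^sup>+x. ennreal (1 / 2) * indicator {-1<..<1} x * g (c * x) \<partial>lborel)"
      unfolding start using True
      by (intro nn_integral_cong)
         (simp add: nn_integral_multc nn_integral_archimedean_density_slice)
    also have "\<dots> = ?J"
      using c
    proof
      assume "c = -1"
      then show ?thesis
        by (subst (2) nn_integral_real_affine[where c="-1" and t=0])
           (auto intro!: nn_integral_cong split: split_indicator)
    qed simp
    finally show ?thesis .
  next
    case s: False
    text \<open>Substituting \<open>u = c x + s y\<close> for \<open>y\<close> and then \<open>x = c u + s v\<close> amounts to rotating
      the plane, but only uses one-dimensional affine substitutions.\<close>
    have rot: "archimedean_density (c * u + s * v, (u - c * (c * u + s * v)) / s) = archimedean_density (u, v)" for u v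
    proof -
      have "(u - c * (c * u + s * v)) / s = (u * (1 - c\<^sup>2) - c * s * v) / s"
        by (simp add: algebra_simps power2_eq_square)
      also have "\<dots> = (u * s\<^sup>2 - c * s * v) / s" using cs by (simp add: eq_diff_eq[symmetric])
      also have "\<dots> = s * u - c * v" using s by (simp add: field_simps power2_eq_square)
      finally have y: "(u - c * (c * u + s * v)) / s = s * u - c * v" .
      have "(c * u + s * v)\<^sup>2 + (s * u - c * v)\<^sup>2 = (c\<^sup>2 + s\<^sup>2) * (u\<^sup>2 + v\<^sup>2)"
        by (simp add: power2_eq_square algebra_simps)
      then have n: "(c * u + s * v)\<^sup>2 + (s * u - c * v)\<^sup>2 = u\<^sup>2 + v\<^sup>2" by (simp add: cs)
      then have "1 - (c * u + s * v)\<^sup>2 - (s * u - c * v)\<^sup>2 = 1 - u\<^sup>2 - v\<^sup>2" by linarith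
      then show ?thesis unfolding y archimedean_density_def using n by simp
    qed
    have "?I = (\<integral>\<^sup>+x. ennreal \<bar>1 / s\<bar> * (\<integral>\<^sup>+u. archimedean_density (x, (u - c * x) / s) * g u \<partial>lborel) \<partial>lborel)"
      unfolding start
    proof (intro nn_integral_cong)
      fix x
      have "(\<integral>\<^sup>+y. archimedean_density (x, y) * g (c * x + s * y) \<partial>lborel)
        = ennreal \<bar>1 / s\<bar> * (\<integral>\<^sup>+u. archimedean_density (x, - c * x / s + 1 / s * u) * g (c * x + s * (- c * x / s + 1 / s * u)) \<partial>lborel)"
        using s by (subst nn_integral_real_affine[where c="1/s" and t="- c * x / s"]) auto
      also have "\<dots> = ennreal \<bar>1 / s\<bar> * (\<integral>\<^sup>+u. archimedean_density (x, (u - c * x) / s) * g u \<partial>lborel)"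
      proof -
        have "- c * x / s + 1 / s * u = (u - c * x) / s" "c * x + s * ((u - c * x) / s) = u" for u
          using s by (auto simp: field_simps)
        then show ?thesis by presburger
      qed
      finally show "(\<integral>\<^sup>+y. archimedean_density (x, y) * g (c * x + s * y) \<partial>lborel)
        = ennreal \<bar>1 / s\<bar> * (\<integral>\<^sup>+u. archimedean_density (x, (u - c * x) / s) * g u \<partial>lborel)" .
    qed
    also have "\<dots> = ennreal \<bar>1 / s\<bar> * (\<integral>\<^sup>+x. \<integral>\<^sup>+u. archimedean_density (x, (u - c * x) / s) * g u \<partial>lborel \<partial>lborel)"
      by (rule nn_integral_cmult) measurable
    also have "(\<integral>\<^sup>+x. \<integral>\<^sup>+u. archimedean_density (x, (u - c * x) / s) * g u \<partial>lborel \<partial>lborel)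
        = (\<integral>\<^sup>+u. \<integral>\<^sup>+x. archimedean_density (x, (u - c * x) / s) * g u \<partial>lborel \<partial>lborel)"
      by (rule lborel_pair.Fubini'[symmetric]) measurable
    also have "\<dots> = (\<integral>\<^sup>+u. ennreal \<bar>s\<bar> * (ennreal (1 / 2) * indicator {-1<..<1} u * g u) \<partial>lborel)"
    proof (intro nn_integral_cong)
      fix u
      have "(\<integral>\<^sup>+x. archimedean_density (x, (u - c * x) / s) * g u \<partial>lborel)
        = ennreal \<bar>s\<bar> * (\<integral>\<^sup>+v. archimedean_density (c * u + s * v, (u - c * (c * u + s * v)) / s) * g u \<partial>lborel)"
        using s by (subst nn_integral_real_affine[where c=s and t="c * u"]) auto
      also have "\<dots> = ennreal \<bar>s\<bar> * ((\<integral>\<^sup>+v. archimedean_density (u, v) \<partial>lborel) * g u)"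
        unfolding rot by (subst nn_integral_multc) auto
      finally show "(\<integral>\<^sup>+x. archimedean_density (x, (u - c * x) / s) * g u \<partial>lborel)
          = ennreal \<bar>s\<bar> * (ennreal (1 / 2) * indicator {-1<..<1} u * g u)"
        unfolding nn_integral_archimedean_density_slice .
    qed
    also have "\<dots> = ennreal \<bar>s\<bar> * ?J"
      by (rule nn_integral_cmult) measurable
    \<comment> \<open>The Jacobian factors of the two substitutions cancel.\<close>
    also have "ennreal \<bar>1 / s\<bar> * (ennreal \<bar>s\<bar> * ?J) = ?J"
      using s by (simp add: mult.assoc[symmetric] ennreal_mult[symmetric])
    finally show ?thesis .
  qed
  then show ?thesis by (simp add: nn_integral_uniform_symmetric)
qed

lemma distr_archimedean_projection:
  fixes c s :: real
  assumes "c\<^sup>2 + s\<^sup>2 = 1"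
  shows "distr archimedean_measure borel (\<lambda>p. c * fst p + s * snd p) = uniform_measure lborel {-1..1}"
proof (rule measure_eqI)
  fix A assume "A \<in> sets (distr archimedean_measure borel (\<lambda>p. c * fst p + s * snd p))"
  then have A [measurable]: "A \<in> sets borel" by simp
  have "emeasure (distr archimedean_measure borel (\<lambda>p. c * fst p + s * snd p)) A
      = (\<integral>\<^sup>+x. indicator A x \<partial>distr archimedean_measure borel (\<lambda>p. c * fst p + s * snd p))"
    by (subst nn_integral_indicator) auto
  also have "\<dots> = (\<integral>\<^sup>+p. indicator A (c * fst p + s * snd p) \<partial>archimedean_measure)"
    by (subst nn_integral_distr) auto
  also have "\<dots> = (\<integral>\<^sup>+u. indicator A u \<partial>uniform_measure lborel {-1..1})"
    using assms by (rule nn_integral_archimedean_projection) auto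
  also have "\<dots> = emeasure (uniform_measure lborel {-1..1}) A"
    by (subst nn_integral_indicator) auto
  finally show "emeasure (distr archimedean_measure borel (\<lambda>p. c * fst p + s * snd p)) A = \<dots>" .
qed simp

lemma prob_space_uniform_symmetric: "prob_space (uniform_measure lborel {-1..1::real})"
  by (rule prob_space_uniform_measure) auto

text \<open>The total mass is read off from the first coordinate: its image measure is uniform and
  hence a probability measure.\<close>

lemma prob_space_archimedean_measure: "prob_space archimedean_measure"
proof -
  have "(\<lambda>p. 1 * fst p + 0 * snd p) \<in> borel_measurable archimedean_measure"
    by measurable
  moreover have "prob_space (distr archimedean_measure borel (\<lambda>p. 1 * fst p + 0 * snd p))"
    by (subst distr_archimedean_projection) (auto intro: prob_space_uniform_symmetric)
  ultimately show ?thesis by (rule prob_space_distrD)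
qed

section \<open>Measures determined by their projections\<close>

text \<open>Closed sets are stable under intersection and generate the Borel sets, and the indicator
  of a nonempty closed set \<open>C\<close> is the limit of the tent functions
  \<open>max 0 (1 - n * infdist x C)\<close>, which are continuous with values in
  \<open>{0..1}\<close>. Dominated convergence carries equality of integrals over to
  \<open>C\<close>.\<close>

lemma measure_eq_if_integrals_eq:
  fixes M N :: "'a::metric_space measure"
  assumes "prob_space M" "prob_space N" and sM: "sets M = sets borel" and sN: "sets N = sets borel"
    and eq: "\<And>f::'a \<Rightarrow> real. continuous_on UNIV f \<Longrightarrow> (\<And>x. f x \<in> {0..1}) \<Longrightarrow> (\<integral>x. f x \<partial>M) = (\<integral>x. f x \<partial>N)"
  shows "M = N"
proof -
  interpret M: prob_space M by fact
  interpret N: prob_space N by fact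
  have lim: "(\<lambda>n. \<integral>x. max 0 (1 - real n * infdist x C) \<partial>K) \<longlonglongrightarrow> measure K C"
    if K: "prob_space K" "sets K = sets borel" and C: "closed C" "C \<noteq> {}" for K and C :: "'a set"
  proof -
    interpret K: prob_space K by fact
    have [measurable]: "C \<in> sets K" using C K by auto
    have "(\<lambda>n. \<integral>x. max 0 (1 - real n * infdist x C) \<partial>K) \<longlonglongrightarrow> (\<integral>x. indicator C x \<partial>K)"
    proof (rule integral_dominated_convergence[where w="\<lambda>_. 1"])
      show "(\<lambda>x. max 0 (1 - real n * infdist x C)) \<in> borel_measurable K" for n
        unfolding measurable_cong_sets[OF K(2) refl]
        by (intro borel_measurable_continuous_onI continuous_intros)
      show "AE x in K. (\<lambda>n. max 0 (1 - real n * infdist x C)) \<longlonglongrightarrow> indicator C x"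
      proof (intro always_eventually allI)
        fix x
        show "(\<lambda>n. max 0 (1 - real n * infdist x C)) \<longlonglongrightarrow> indicator C x"
        proof (cases "x \<in> C")
          case True
          then show ?thesis by simp
        next
          case False
          then have d: "infdist x C > 0"
            using C in_closed_iff_infdist_zero[OF C] infdist_nonneg[of x C] by (simp add: less_le)
          have "\<forall>\<^sub>F n in sequentially. max 0 (1 - real n * infdist x C) = 0"
            using eventually_ge_at_top[of "nat \<lceil>1 / infdist x C\<rceil>"]
          proof eventually_elim
            case (elim n)
            then have "1 / infdist x C \<le> real n" by linarith
            then show ?case using d by (simp add: field_simps)
          qed
          then show ?thesis using False by (simp add: tendsto_eventually)
        qed
      qed
    qed (auto simp: infdist_nonneg)
    then show ?thesis by simp
  qed
  show ?thesis
  proof (rule measure_eqI_generator_eq)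
    show "Int_stable (Collect (closed :: 'a set \<Rightarrow> bool))" by (auto simp: Int_stable_def)
    show "sets M = sigma_sets UNIV (Collect closed)" "sets N = sigma_sets UNIV (Collect closed)"
      unfolding sM sN by (auto simp: borel_eq_closed)
    show "range (\<lambda>_::nat. UNIV :: 'a set) \<subseteq> Collect closed" by auto
    fix C :: "'a set" assume "C \<in> Collect closed"
    then have C: "closed C" by simp
    show "emeasure M C = emeasure N C"
    \<comment> \<open>\<open>infdist x {}\<close> is 0 by convention, so the tent functions do not
      approximate the indicator of the empty set.\<close>
    proof (cases "C = {}")
      case False
      have "(\<integral>x. max 0 (1 - real n * infdist x C) \<partial>M) = (\<integral>x. max 0 (1 - real n * infdist x C) \<partial>N)" for n
        by (intro eq continuous_intros) (auto simp: infdist_nonneg)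
      then have "measure M C = measure N C"
        using LIMSEQ_unique[OF lim[OF \<open>prob_space M\<close> sM C False]] lim[OF \<open>prob_space N\<close> sN C False] by simp
      then show ?thesis by (simp add: M.emeasure_eq_measure N.emeasure_eq_measure)
    qed simp
  qed auto
qed

text \<open>The span of the ridge functions \<open>cos (a \<bullet> x + c)\<close> is closed under products, so
  Stone-Weierstrass applies to it.\<close>

inductive_set cosine_span :: "('a::euclidean_space \<Rightarrow> real) set" where
  wave: "(\<lambda>x. r * cos (a \<bullet> x + c)) \<in> cosine_span"
| add: "f \<in> cosine_span \<Longrightarrow> g \<in> cosine_span \<Longrightarrow> (\<lambda>x. f x + g x) \<in> cosine_span"

lemma continuous_on_cosine_span: "f \<in> cosine_span \<Longrightarrow> continuous_on S f"
  by (induction rule: cosine_span.induct) (auto intro!: continuous_intros)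

lemma cosine_span_bounded: "f \<in> cosine_span \<Longrightarrow> \<exists>B. \<forall>x. \<bar>f x\<bar> \<le> B"
proof (induction rule: cosine_span.induct)
  case (wave r a c)
  have "\<bar>r * cos (a \<bullet> x + c)\<bar> \<le> \<bar>r\<bar>" for x
    using mult_left_mono[OF abs_cos_le_one, of "\<bar>r\<bar>" "a \<bullet> x + c"] by (simp add: abs_mult)
  then show ?case by blast
next
  case (add f g)
  then obtain B C where "\<And>x. \<bar>f x\<bar> \<le> B" "\<And>x. \<bar>g x\<bar> \<le> C" by metis
  then have "\<bar>f x + g x\<bar> \<le> B + C" for x by (meson abs_triangle_ineq add_mono order_trans)
  then show ?case by blast
qed

text \<open>By the product-to-sum formula two waves multiply to waves of frequencies
  \<open>a - a'\<close> and \<open>a + a'\<close>. Distributivity handles sums, by an induction on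
  one factor inside the induction on the other.\<close>

lemma cosine_span_mult:
  assumes "f \<in> cosine_span" and "g \<in> cosine_span"
  shows "(\<lambda>x. f x * g x) \<in> cosine_span"
  using assms(1)
proof (induction rule: cosine_span.induct)
  case f: (wave r a c)
  show ?case using assms(2)
  proof (induction rule: cosine_span.induct)
    case (wave r' a' c')
    have "(\<lambda>x. (r * cos (a \<bullet> x + c)) * (r' * cos (a' \<bullet> x + c')))
      = (\<lambda>x. r * r' / 2 * cos ((a - a') \<bullet> x + (c - c')) + r * r' / 2 * cos ((a + a') \<bullet> x + (c + c')))"
    proof
      fix x
      have "cos (a \<bullet> x + c) * cos (a' \<bullet> x + c')
          = (cos ((a - a') \<bullet> x + (c - c')) + cos ((a + a') \<bullet> x + (c + c'))) / 2"
        unfolding cos_times_cos by (simp add: algebra_simps inner_simps)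
      then show "(r * cos (a \<bullet> x + c)) * (r' * cos (a' \<bullet> x + c'))
        = r * r' / 2 * cos ((a - a') \<bullet> x + (c - c')) + r * r' / 2 * cos ((a + a') \<bullet> x + (c + c'))"
        by (simp add: algebra_simps add_divide_distrib)
    qed
    then show ?case by (simp only: cosine_span.intros)
  qed (simp add: distrib_left cosine_span.add)
qed (simp add: distrib_right cosine_span.add)

text \<open>Cramer-Wold for compactly supported measures, with \<open>cos\<close> in place of the characteristic function.\<close>

lemma measure_eq_if_cosine_integrals_eq:
  fixes M N :: "'a::euclidean_space measure"
  assumes M: "prob_space M" "sets M = sets borel" and N: "prob_space N" "sets N = sets borel"
    and S: "compact S" "AE x in M. x \<in> S" "AE x in N. x \<in> S"
    and eq: "\<And>a c. (\<integral>x. cos (a \<bullet> x + c) \<partial>M) = (\<integral>x. cos (a \<bullet> x + c) \<partial>N)"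
  shows "M = N"
proof (rule measure_eq_if_integrals_eq[OF M(1) N(1) M(2) N(2)])
  have int_span: "integrable K f"
    if K: "prob_space K" "sets K = sets borel" and f: "f \<in> cosine_span" for K and f :: "'a \<Rightarrow> real"
  proof -
    interpret K: prob_space K by fact
    obtain B where "\<And>x. \<bar>f x\<bar> \<le> B" using cosine_span_bounded[OF f] by metis
    moreover have "f \<in> borel_measurable K"
      unfolding measurable_cong_sets[OF K(2) refl]
      by (intro borel_measurable_continuous_onI continuous_on_cosine_span f)
    ultimately show ?thesis
      by (intro K.integrable_const_bound[where B=B]) auto
  qed
  have eq_span: "(\<integral>x. f x \<partial>M) = (\<integral>x. f x \<partial>N)" if "f \<in> cosine_span" for f
    using that
  proof (induction rule: cosine_span.induct)
    case (wave r a c)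
    show ?case using eq by simp
  next
    case (add f g)
    then show ?case using int_span[OF M] int_span[OF N] by simp
  qed
  interpret function_ring_on cosine_span S
  proof
    show "(\<lambda>_::'a. c) \<in> cosine_span" for c using cosine_span.wave[of c 0 0] by simp
    \<comment> \<open>The frequency is scaled so that the phases at \<open>x\<close> and
      \<open>y\<close> differ by 1, and the shift makes them 1 and 0, where \<open>cos\<close> takes
      different values.\<close>
    fix x y :: 'a assume "x \<noteq> y"
    define d where "d = x - y"
    define a where "a = (1 / (d \<bullet> d)) *\<^sub>R d"
    have "d \<bullet> d \<noteq> 0" using \<open>x \<noteq> y\<close> by (simp add: d_def)
    then have "a \<bullet> x - a \<bullet> y = 1"
      unfolding inner_diff_right[symmetric] d_def[symmetric] a_def by simp
    then have "1 * cos (a \<bullet> x + - (a \<bullet> y)) \<noteq> 1 * cos (a \<bullet> y + - (a \<bullet> y))"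
      using cos_monotone_0_pi[of 0 1] pi_gt3 by simp
    then show "\<exists>f\<in>cosine_span. f x \<noteq> f y"
      using cosine_span.wave[of 1 a "- (a \<bullet> y)"] by (intro bexI) auto
  qed (auto intro: S continuous_on_cosine_span cosine_span.add cosine_span_mult)
  fix f :: "'a \<Rightarrow> real"
  assume f: "continuous_on UNIV f" "\<And>x. f x \<in> {0..1}"
  \<comment> \<open>The measures are carried by \<open>S\<close>, so an approximation that is
    uniform on \<open>S\<close> alone controls the integrals.\<close>
  have approx: "\<bar>(\<integral>x. f x \<partial>K) - (\<integral>x. g x \<partial>K)\<bar> \<le> e"
    if K: "prob_space K" "sets K = sets borel" "AE x in K. x \<in> S" and g: "g \<in> cosine_span"
      and e: "\<And>x. x \<in> S \<Longrightarrow> \<bar>f x - g x\<bar> < e" for K g e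
  proof -
    interpret K: prob_space K by fact
    have "f \<in> borel_measurable K"
      unfolding measurable_cong_sets[OF K(2) refl] using f(1) by (rule borel_measurable_continuous_onI)
    then have i: "integrable K f"
      using f(2) by (intro K.integrable_const_bound[where B=1]) auto
    have ae: "AE x in K. \<bar>f x - g x\<bar> \<le> e" using K(3) e by (auto elim!: eventually_mono intro: less_imp_le)
    have "\<bar>(\<integral>x. f x \<partial>K) - (\<integral>x. g x \<partial>K)\<bar> = \<bar>\<integral>x. f x - g x \<partial>K\<bar>"
      using i int_span[OF K(1,2) g] by simp
    also have "\<dots> \<le> (\<integral>x. \<bar>f x - g x\<bar> \<partial>K)" by (rule integral_abs_bound)
    also have "\<dots> \<le> (\<integral>x. e \<partial>K)"
      using i int_span[OF K(1,2) g] ae by (intro integral_mono_AE) auto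
    finally show ?thesis by (simp add: K.prob_space)
  qed
  show "(\<integral>x. f x \<partial>M) = (\<integral>x. f x \<partial>N)"
  proof (rule ccontr)
    assume "(\<integral>x. f x \<partial>M) \<noteq> (\<integral>x. f x \<partial>N)"
    \<comment> \<open>Each integral moves by at most a third of the gap when \<open>f\<close> is
      replaced by \<open>g\<close>, whose two integrals agree, so two thirds would have to cover the
      whole gap.\<close>
    then have e: "\<bar>(\<integral>x. f x \<partial>M) - (\<integral>x. f x \<partial>N)\<bar> / 3 > 0" (is "?e > 0") by simp
    obtain g where g: "g \<in> cosine_span" "\<And>x. x \<in> S \<Longrightarrow> \<bar>f x - g x\<bar> < ?e"
      using Stone_Weierstrass_basic[OF continuous_on_subset[OF f(1)] e] by auto
    have "\<bar>(\<integral>x. f x \<partial>M) - (\<integral>x. g x \<partial>M)\<bar> \<le> ?e"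
      by (rule approx[OF M S(2) g(1)]) (rule g(2))
    moreover have "\<bar>(\<integral>x. f x \<partial>N) - (\<integral>x. g x \<partial>N)\<bar> \<le> ?e"
      by (rule approx[OF N S(3) g(1)]) (rule g(2))
    ultimately show False
      using abs_triangle_ineq4[of "(\<integral>x. f x \<partial>M) - (\<integral>x. g x \<partial>M)" "(\<integral>x. f x \<partial>N) - (\<integral>x. g x \<partial>N)"]
        eq_span[OF g(1)] e by simp
  qed
qed

section \<open>A subadditive quadratic form\<close>

text \<open>The minimum of \<open>\<integral> (u'\<^sup>2 - u\<^sup>2)\<close> over the paths \<open>u\<close> from \<open>x\<close> to \<open>y\<close> in time \<open>a < pi\<close>.\<close>

definition jacobi_form :: "real \<Rightarrow> real \<Rightarrow> real \<Rightarrow> real" where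
  "jacobi_form a x y = ((x\<^sup>2 + y\<^sup>2) * cos a - 2 * x * y) / sin a"

text \<open>This completes the square in \<open>y\<close>: the value
  \<open>(sin b * x + sin a * z) / sin (a + b)\<close> is taken at time \<open>a\<close> by the
  solution of u'' = -u that joins \<open>x\<close> at time 0 to \<open>z\<close> at time
  \<open>a + b\<close>. After clearing denominators the claim is polynomial in the sines and
  cosines.\<close>

lemma jacobi_form_add:
  assumes "sin a \<noteq> 0" "sin b \<noteq> 0" "sin (a + b) \<noteq> 0"
  shows "jacobi_form a x y + jacobi_form b y z = jacobi_form (a + b) x z
    + sin (a + b) / (sin a * sin b) * (y - (sin b * x + sin a * z) / sin (a + b))\<^sup>2"
proof -
  define p q u v where "p = sin a" "q = sin b" "u = cos a" "v = cos b"
  have pu: "u\<^sup>2 = 1 - p\<^sup>2" and qv: "v\<^sup>2 = 1 - q\<^sup>2"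
    by (simp_all add: p_q_u_v_def cos_squared_eq)
  define w where "w = p * v + u * q"
  have w: "sin (a + b) = w" and c: "cos (a + b) = u * v - p * q"
    by (simp_all add: w_def p_q_u_v_def sin_add cos_add)
  have nz: "p \<noteq> 0" "q \<noteq> 0" "w \<noteq> 0" using assms w by (simp_all add: p_q_u_v_def)
  \<comment> \<open>These are the subtraction formulas for \<open>sin b\<close> and
    \<open>sin a\<close>, with \<open>b = (a + b) - a\<close> and
    \<open>a = (a + b) - b\<close>.\<close>
  have k1: "w * u = q + p * (u * v - p * q)"
    using pu unfolding w_def by algebra
  have k2: "w * v = p + q * (u * v - p * q)"
    using qv unfolding w_def by algebra
  have "(((x\<^sup>2 + y\<^sup>2) * u - 2 * x * y) * q + ((y\<^sup>2 + z\<^sup>2) * v - 2 * y * z) * p) * w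
      = ((x\<^sup>2 + z\<^sup>2) * (u * v - p * q) - 2 * x * z) * p * q + (w * y - (q * x + p * z))\<^sup>2"
    using k1 k2 w_def by algebra
  moreover have "(w * y - (q * x + p * z))\<^sup>2 = w\<^sup>2 * (y - (q * x + p * z) / w)\<^sup>2"
    using nz by (simp add: power_mult_distrib[symmetric] right_diff_distrib)
  ultimately have "(((x\<^sup>2 + y\<^sup>2) * u - 2 * x * y) * q + ((y\<^sup>2 + z\<^sup>2) * v - 2 * y * z) * p) * w
      = ((x\<^sup>2 + z\<^sup>2) * (u * v - p * q) - 2 * x * z) * p * q + w\<^sup>2 * (y - (q * x + p * z) / w)\<^sup>2"
    by simp
  then have "((x\<^sup>2 + y\<^sup>2) * u - 2 * x * y) / p + ((y\<^sup>2 + z\<^sup>2) * v - 2 * y * z) / q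
      = ((x\<^sup>2 + z\<^sup>2) * (u * v - p * q) - 2 * x * z) / w + w / (p * q) * (y - (q * x + p * z) / w)\<^sup>2"
    using nz by (simp add: divide_simps power2_eq_square)
  then show ?thesis
    unfolding jacobi_form_def w c by (simp add: p_q_u_v_def)
qed

text \<open>One step is added at a time and the square of \<open>jacobi_form_add\<close> is dropped:
  while the total angle stays below \<open>pi\<close>, all three sines are positive, and so is the
  coefficient of the square. The induction starts at one step, since angle 0 would put
  \<open>sin 0\<close> in the denominator.\<close>

lemma jacobi_form_chain:
  assumes "0 < a" and "0 < n" and "real n * a < pi"
  shows "jacobi_form (real n * a) (x m) (x (m + n)) \<le> (\<Sum>i\<in>{m..<m + n}. jacobi_form a (x i) (x (Suc i)))"
  using assms(2,3)
proof (induction n rule: nat_induct_non_zero)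
  case 1
  then show ?case by simp
next
  case (Suc n)
  have lt: "real n * a + a < pi" using Suc.prems by (simp add: algebra_simps)
  have p: "0 < real n * a" using Suc.hyps assms(1) by simp
  have s: "sin (real n * a) > 0" "sin a > 0" "sin (real n * a + a) > 0"
    using lt p assms(1) by (auto intro!: sin_gt_zero)
  have "jacobi_form (real (Suc n) * a) (x m) (x (m + Suc n))
      \<le> jacobi_form (real n * a) (x m) (x (m + n)) + jacobi_form a (x (m + n)) (x (Suc (m + n)))"
    using jacobi_form_add[of "real n * a" a "x m" "x (m + n)" "x (Suc (m + n))"] s
    by (simp add: algebra_simps)
  also have "\<dots> \<le> (\<Sum>i\<in>{m..<m + Suc n}. jacobi_form a (x i) (x (Suc i)))"
    using Suc.IH lt assms(1) by simp
  finally show ?case .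
qed

text \<open>By \<open>jacobi_form_add\<close> the square even has the coefficient \<open>1 / (sin \<theta> * cos \<theta>) \<ge> 1\<close>.\<close>

lemma jacobi_form_quarter_split:
  assumes "0 < \<theta>" and "\<theta> < pi / 2"
  shows "(y - (cos \<theta> * x + sin \<theta> * z))\<^sup>2 \<le> jacobi_form \<theta> x y + jacobi_form (pi / 2 - \<theta>) y z + 2 * x * z"
proof -
  have s: "sin \<theta> > 0" "cos \<theta> > 0" using assms by (auto intro: sin_gt_zero cos_gt_zero)
  have "sin \<theta> * cos \<theta> \<le> 1 * 1" using s by (intro mult_mono) auto
  then have "1 \<le> 1 / (sin \<theta> * cos \<theta>)" using s by simp
  then have "1 * (y - (cos \<theta> * x + sin \<theta> * z))\<^sup>2 \<le> 1 / (sin \<theta> * cos \<theta>) * (y - (cos \<theta> * x + sin \<theta> * z))\<^sup>2"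
    by (intro mult_right_mono) auto
  also have "\<dots> = jacobi_form \<theta> x y + jacobi_form (pi / 2 - \<theta>) y z - jacobi_form (pi / 2) x z"
    using jacobi_form_add[of \<theta> "pi / 2 - \<theta>" x y z] s by (simp add: sin_diff)
  also have "jacobi_form (pi / 2) x z = - 2 * x * z" by (simp add: jacobi_form_def)
  finally show ?thesis by simp
qed

text \<open>The whole period has angle \<open>pi\<close>, where the denominator of
  \<open>jacobi_form\<close> vanishes, so chaining is done on pieces of angle at most
  \<open>pi / 2\<close>. The bounds \<open>- 2 * x 0 * x H\<close> and \<open>2 * x 0 * x H\<close>
  of the two halves cancel by antiperiodicity; splitting the half that contains \<open>k\<close>
  once more leaves the square. Taking \<open>2 * H\<close> steps puts the midpoint on the
  grid.\<close>

lemma jacobi_form_antiperiodic: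
  fixes x :: "nat \<Rightarrow> real"
  assumes H: "0 < H" and k: "k \<le> 2 * H" and anti: "x (2 * H) = - x 0"
  shows "(x k - (cos (pi * k / (2 * H)) * x 0 + sin (pi * k / (2 * H)) * x H))\<^sup>2
    \<le> (\<Sum>i<2 * H. jacobi_form (pi / (2 * H)) (x i) (x (Suc i)))"
proof -
  define a where "a = pi / (2 * H)"
  define \<theta> where "\<theta> = pi * k / (2 * H)"
  define S where "S = (\<lambda>i j. \<Sum>i\<in>{i..<j}. jacobi_form a (x i) (x (Suc i)))"
  have a: "a > 0" "real H * a = pi / 2" using H by (auto simp: a_def)
  have ka: "real k * a = \<theta>" by (simp add: a_def \<theta>_def)
  have le: "jacobi_form (real (j - i) * a) (x i) (x j) \<le> S i j" if "i < j" "real (j - i) * a < pi" for i j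
    using jacobi_form_chain[of a "j - i" x i] that a(1) by (simp add: S_def)
  have cat: "S i j + S j l = S i l" if "i \<le> j" "j \<le> l" for i j l
    unfolding S_def using that by (rule sum.atLeastLessThan_concat)
  have half: "jacobi_form (pi / 2) u v = - 2 * u * v" for u v by (simp add: jacobi_form_def)
  have first: "- 2 * x 0 * x H \<le> S 0 H"
    using le[of 0 H] H a half by simp
  have second: "2 * x 0 * x H \<le> S H (2 * H)"
  proof -
    have r: "real (2 * H - H) * a = pi / 2" using a by simp
    have "jacobi_form (pi / 2) (x H) (- x 0) \<le> S H (2 * H)"
      using le[of H "2 * H", unfolded r anti] H by simp
    then show ?thesis by (simp add: half mult_ac)
  qed
  have "(x k - (cos \<theta> * x 0 + sin \<theta> * x H))\<^sup>2 \<le> S 0 (2 * H)"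
  proof -
    \<comment> \<open>At \<open>0\<close>, \<open>H\<close> and \<open>2 * H\<close> the predicted
      value is \<open>x k\<close> itself and the square vanishes. A split there would produce a
      piece of angle 0, so these points are kept apart.\<close>
    consider "k = 0" | "0 < k" "k < H" | "k = H" | "H < k" "k < 2 * H" | "k = 2 * H"
      using k by linarith
    then show ?thesis
    proof cases
      case 1
      then show ?thesis using first second cat[of 0 H "2 * H"] by (simp add: \<theta>_def)
    next
      case 3
      then show ?thesis using first second cat[of 0 H "2 * H"] H by (simp add: \<theta>_def)
    next
      case 5
      then show ?thesis using first second cat[of 0 H "2 * H"] H anti by (simp add: \<theta>_def)
    next
      case 2
      have \<theta>: "0 < \<theta>" "\<theta> < pi / 2" using 2 H by (auto simp: \<theta>_def field_simps)
      have rest: "real (H - k) * a = pi / 2 - \<theta>" using 2 a ka by (simp add: of_nat_diff algebra_simps)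
      have "jacobi_form \<theta> (x 0) (x k) \<le> S 0 k"
        using le[of 0 k] 2 \<theta> ka by simp
      moreover have "jacobi_form (pi / 2 - \<theta>) (x k) (x H) \<le> S k H"
        using le[of k H] 2 \<theta> rest by simp
      ultimately show ?thesis
        using jacobi_form_quarter_split[OF \<theta>, of "x k" "x 0" "x H"] second
          cat[of 0 k H] cat[of 0 H "2 * H"] 2 by linarith
    next
      case 4
      \<comment> \<open>In the second half the angle is counted from the midpoint, and the values
        run from \<open>x H\<close> to \<open>- x 0\<close>; the shift by \<open>pi / 2\<close>
        turns this interpolation into the one in the claim.\<close>
      define \<eta> where "\<eta> = \<theta> - pi / 2"
      have \<eta>: "0 < \<eta>" "\<eta> < pi / 2" using 4 H by (auto simp: \<eta>_def \<theta>_def field_simps)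
      have r1: "real (k - H) * a = \<eta>" using 4 a ka by (simp add: \<eta>_def of_nat_diff algebra_simps)
      have r2: "real (2 * H - k) * a = pi / 2 - \<eta>"
        using 4 a ka by (simp add: \<eta>_def of_nat_diff algebra_simps)
      have "jacobi_form \<eta> (x H) (x k) \<le> S H k"
        using le[of H k] 4 \<eta> r1 by simp
      moreover have "jacobi_form (pi / 2 - \<eta>) (x k) (- x 0) \<le> S k (2 * H)"
        using le[of k "2 * H"] 4 \<eta> r2 anti by simp
      moreover have "cos \<eta> * x H + sin \<eta> * (- x 0) = cos \<theta> * x 0 + sin \<theta> * x H"
        by (simp add: \<eta>_def cos_diff sin_diff)
      ultimately show ?thesis
        using jacobi_form_quarter_split[OF \<eta>, of "x k" "x H" "- x 0"] first
          cat[of H k "2 * H"] cat[of 0 H "2 * H"] 4 by (simp add: mult_ac)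
    qed
  qed
  then show ?thesis by (simp add: S_def a_def \<theta>_def lessThan_atLeast0)
qed

section \<open>Lower bound for the energy of antiperiodic processes\<close>

lemma nn_integral_square_uniform_symmetric:
  "(\<integral>\<^sup>+u. ennreal (u\<^sup>2) \<partial>uniform_measure lborel {-1..1::real}) = ennreal (1 / 3)"
proof -
  have "(\<integral>\<^sup>+u. ennreal (u\<^sup>2) * indicator {-1..1::real} u \<partial>lborel) = ennreal (1 ^ 3 / 3 - (-1) ^ 3 / 3)"
    by (rule nn_integral_FTC_Icc) (auto intro!: derivative_eq_intros)
  then have "(\<integral>\<^sup>+u. ennreal (u\<^sup>2) \<partial>uniform_measure lborel {-1..1::real}) = ennreal (2 / 3) / ennreal 2"
    by (subst nn_integral_uniform_measure) auto
  then show ?thesis by (subst (asm) divide_ennreal) auto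
qed

lemma permuton_process_prob_space: "permuton_process M X \<Longrightarrow> prob_space M"
  by (simp add: permuton_process_def)

lemma permuton_process_measurable:
  "permuton_process M X \<Longrightarrow> 0 \<le> t \<Longrightarrow> t \<le> 1 \<Longrightarrow> X t \<in> borel_measurable M"
  by (simp add: permuton_process_def)

lemma permuton_process_bounded:
  assumes "permuton_process M X" and "0 \<le> t" and "t \<le> 1"
  shows "AE \<omega> in M. \<bar>X t \<omega>\<bar> \<le> 1"
proof -
  have "AE \<omega> in M. continuous_on {0..1} (\<lambda>t. X t \<omega>) \<and> (\<forall>t\<in>{0..1}. X t \<omega> \<in> {-1..1})"
    using assms(1) by (simp add: permuton_process_def)
  then show ?thesis by eventually_elim (use assms(2,3) in \<open>auto simp: abs_le_iff\<close>)
qed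

lemma permuton_process_integrable_mult:
  assumes X: "permuton_process M X" and s: "0 \<le> s" "s \<le> 1" and t: "0 \<le> t" "t \<le> 1"
  shows "integrable M (\<lambda>\<omega>. X s \<omega> * X t \<omega>)"
proof -
  interpret prob_space M by (rule permuton_process_prob_space) fact
  have "AE \<omega> in M. norm (X s \<omega> * X t \<omega>) \<le> 1"
    using permuton_process_bounded[OF X s] permuton_process_bounded[OF X t]
    by eventually_elim (simp add: abs_mult mult_le_one)
  then show ?thesis
    using permuton_process_measurable[OF X s] permuton_process_measurable[OF X t]
    by (intro integrable_const_bound) auto
qed

lemma permuton_process_second_moment:
  assumes X: "permuton_process M X" and t: "0 \<le> t" "t \<le> 1"
  shows "(\<integral>\<omega>. (X t \<omega>)\<^sup>2 \<partial>M) = 1 / 3"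
proof -
  have [measurable]: "X t \<in> borel_measurable M" by (rule permuton_process_measurable[OF X t])
  have "(\<integral>\<^sup>+\<omega>. ennreal ((X t \<omega>)\<^sup>2) \<partial>M) = (\<integral>\<^sup>+u. ennreal (u\<^sup>2) \<partial>distr M borel (X t))"
    by (subst nn_integral_distr) auto
  also have "\<dots> = ennreal (1 / 3)"
    using X t by (simp add: permuton_process_def nn_integral_square_uniform_symmetric)
  finally show ?thesis
    by (subst integral_eq_nn_integral) auto
qed

lemma energy_ge_uniform_partition:
  assumes "0 < N"
  shows "(\<Sum>i<N. (\<integral>\<^sup>+ \<omega>. ennreal (\<bar>X (real (Suc i) / real N) \<omega> - X (real i / real N) \<omega>\<bar>\<^sup>2) \<partial>M) / ennreal (1 / real N))
    \<le> energy M X"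
proof -
  let ?t = "\<lambda>i. real i / real N"
  have "(N, ?t) \<in> unit_partitions"
    using assms by (auto simp: unit_partitions_def divide_strict_right_mono)
  then have "(case (N, ?t) of (k, t) \<Rightarrow>
       \<Sum>i<k. (\<integral>\<^sup>+ \<omega>. ennreal (\<bar>X (t (Suc i)) \<omega> - X (t i) \<omega>\<bar>\<^sup>2) \<partial>M) / ennreal (t (Suc i) - t i)) \<le> energy M X"
    unfolding energy_def by (rule SUP_upper)
  moreover have "?t (Suc i) - ?t i = 1 / real N" for i
    by (simp add: diff_divide_distrib[symmetric])
  ultimately show ?thesis by (simp only: prod.case)
qed

text \<open>\<open>sin a * jacobi_form a\<close> is the squared increment minus
  \<open>1 - cos a\<close> times the squares at both ends, whose expectations are fixed by the
  uniform marginals. Integrating \<open>jacobi_form_antiperiodic\<close> with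
  \<open>a = pi / N\<close> thus bounds the expected squared increments from below, and the factor
  \<open>N\<close>, the inverse mesh, turns their sum into that of the energy.\<close>

lemma energy_ge_excess_mesh:
  assumes X: "permuton_process M X" and anti: "AE \<omega> in M. X 1 \<omega> = - X 0 \<omega>"
    and H: "0 < H" and k: "k \<le> 2 * H"
  defines "N \<equiv> 2 * real H"
  shows "ennreal (2 / 3 * (N\<^sup>2 * (1 - cos (pi / N))) + N * sin (pi / N) *
      (\<integral>\<omega>. (X (real k / N) \<omega> - (cos (pi * (real k / N)) * X 0 \<omega> + sin (pi * (real k / N)) * X (1 / 2) \<omega>))\<^sup>2 \<partial>M))
    \<le> energy M X"
proof -
  define a where "a = pi / N"
  define x where "x = (\<lambda>i \<omega>. X (real i / N) \<omega>)"
  define G where "G = (\<lambda>\<omega>. (x k \<omega> - (cos (pi * (real k / N)) * x 0 \<omega> + sin (pi * (real k / N)) * x H \<omega>))\<^sup>2)"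
  have N: "N > 0" "real (2 * H) = N" using H by (auto simp: N_def)
  have a: "0 < a" "a < pi" using H N by (auto simp: a_def N_def field_simps)
  have sa: "sin a > 0" using a by (intro sin_gt_zero)
  have range: "0 \<le> real i / N" "real i / N \<le> 1" if "i \<le> 2 * H" for i
    using that N H by (auto simp: N_def)
  have int [simp]: "integrable M (\<lambda>\<omega>. x i \<omega> * x j \<omega>)" if "i \<le> 2 * H" "j \<le> 2 * H" for i j
    unfolding x_def by (rule permuton_process_integrable_mult[OF X range[OF that(1)] range[OF that(2)]])
  have int2 [simp]: "integrable M (\<lambda>\<omega>. (x i \<omega>)\<^sup>2)" if "i \<le> 2 * H" for i
    using int[OF that that] by (simp add: power2_eq_square)
  have mom: "(\<integral>\<omega>. (x i \<omega>)\<^sup>2 \<partial>M) = 1 / 3" if "i \<le> 2 * H" for i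
    unfolding x_def by (rule permuton_process_second_moment[OF X range[OF that]])
  define D where "D = (\<lambda>i. \<integral>\<omega>. (x (Suc i) \<omega> - x i \<omega>)\<^sup>2 \<partial>M)"
  have Dint: "integrable M (\<lambda>\<omega>. (x (Suc i) \<omega> - x i \<omega>)\<^sup>2)" if "i < 2 * H" for i
    unfolding power2_diff using that by (auto simp: mult.assoc)
  have Gint: "integrable M G"
  proof -
    define c s where "c = cos (pi * (real k / N))" "s = sin (pi * (real k / N))"
    have "G = (\<lambda>\<omega>. (x k \<omega>)\<^sup>2 + c\<^sup>2 * (x 0 \<omega>)\<^sup>2 + s\<^sup>2 * (x H \<omega>)\<^sup>2 - 2 * c * (x k \<omega> * x 0 \<omega>)
        - 2 * s * (x k \<omega> * x H \<omega>) + 2 * c * s * (x 0 \<omega> * x H \<omega>))"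
      unfolding G_def c_s_def[symmetric] by (simp add: fun_eq_iff power2_eq_square algebra_simps)
    moreover have "integrable M \<dots>"
      using k by (intro Bochner_Integration.integrable_add Bochner_Integration.integrable_diff
          integrable_mult_right int int2) auto
    ultimately show ?thesis by simp
  qed
  have step: "sin a * jacobi_form a (x i \<omega>) (x (Suc i) \<omega>)
      = (x (Suc i) \<omega> - x i \<omega>)\<^sup>2 - (1 - cos a) * ((x i \<omega>)\<^sup>2 + (x (Suc i) \<omega>)\<^sup>2)" for i \<omega>
  proof -
    have "sin a * jacobi_form a (x i \<omega>) (x (Suc i) \<omega>) = ((x i \<omega>)\<^sup>2 + (x (Suc i) \<omega>)\<^sup>2) * cos a - 2 * x i \<omega> * x (Suc i) \<omega>"
      using sa by (simp add: jacobi_form_def)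
    then show ?thesis by (simp add: power2_eq_square algebra_simps)
  qed
  have "AE \<omega> in M. sin a * G \<omega> \<le> (\<Sum>i<2 * H. (x (Suc i) \<omega> - x i \<omega>)\<^sup>2 - (1 - cos a) * ((x i \<omega>)\<^sup>2 + (x (Suc i) \<omega>)\<^sup>2))"
    using anti
  proof eventually_elim
    case (elim \<omega>)
    have "x (2 * H) \<omega> = - x 0 \<omega>" using elim N by (simp add: x_def)
    from jacobi_form_antiperiodic[OF H k, of "\<lambda>i. x i \<omega>", OF this]
    have "sin a * G \<omega> \<le> sin a * (\<Sum>i<2 * H. jacobi_form a (x i \<omega>) (x (Suc i) \<omega>))"
      using sa by (intro mult_left_mono) (auto simp: G_def a_def N_def)
    then show ?case by (simp add: sum_distrib_left step)
  qed
  then have "(\<integral>\<omega>. sin a * G \<omega> \<partial>M)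
      \<le> (\<integral>\<omega>. (\<Sum>i<2 * H. (x (Suc i) \<omega> - x i \<omega>)\<^sup>2 - (1 - cos a) * ((x i \<omega>)\<^sup>2 + (x (Suc i) \<omega>)\<^sup>2)) \<partial>M)"
    using Gint Dint by (intro integral_mono_AE Bochner_Integration.integrable_sum) auto
  \<comment> \<open>Each step has two end points, both with second moment 1/3.\<close>
  also have "\<dots> = (\<Sum>i<2 * H. D i - (1 - cos a) * (2 / 3))"
    using Dint by (subst Bochner_Integration.integral_sum) (auto simp: mom D_def intro!: sum.cong)
  finally have "sin a * (\<integral>\<omega>. G \<omega> \<partial>M) \<le> (\<Sum>i<2 * H. D i) - N * ((1 - cos a) * (2 / 3))"
    using N by (simp add: sum_subtractf)
  then have "N * (sin a * (\<integral>\<omega>. G \<omega> \<partial>M)) \<le> N * ((\<Sum>i<2 * H. D i) - N * ((1 - cos a) * (2 / 3)))"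
    using N by (intro mult_left_mono) auto
  then have main: "2 / 3 * (N\<^sup>2 * (1 - cos a)) + N * sin a * (\<integral>\<omega>. G \<omega> \<partial>M) \<le> (\<Sum>i<2 * H. N * D i)"
    by (simp add: power2_eq_square algebra_simps sum_distrib_left diff_divide_distrib)
  have "ennreal (\<Sum>i<2 * H. N * D i)
      = (\<Sum>i<2 * H. (\<integral>\<^sup>+ \<omega>. ennreal (\<bar>X (real (Suc i) / real (2 * H)) \<omega> - X (real i / real (2 * H)) \<omega>\<bar>\<^sup>2) \<partial>M)
          / ennreal (1 / real (2 * H)))"
  proof (subst sum_ennreal[symmetric], goal_cases)
    case 1
    then show ?case using N by (simp add: D_def)
  next
    case 2
    show ?case
    proof (intro sum.cong refl)
      fix i assume "i \<in> {..<2 * H}"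
      then have "(\<integral>\<^sup>+ \<omega>. ennreal ((x (Suc i) \<omega> - x i \<omega>)\<^sup>2) \<partial>M) = ennreal (D i)"
        unfolding D_def by (intro nn_integral_eq_integral Dint) auto
      moreover have "ennreal (D i) / ennreal (1 / N) = ennreal (N * D i)"
        using N by (subst divide_ennreal) (auto simp: D_def mult.commute)
      ultimately show "ennreal (N * D i) =
          (\<integral>\<^sup>+ \<omega>. ennreal (\<bar>X (real (Suc i) / real (2 * H)) \<omega> - X (real i / real (2 * H)) \<omega>\<bar>\<^sup>2) \<partial>M)
          / ennreal (1 / real (2 * H))"
        unfolding N by (simp add: x_def)
    qed
  qed
  also have "\<dots> \<le> energy M X" using H by (intro energy_ge_uniform_partition) auto
  finally have "ennreal (2 / 3 * (N\<^sup>2 * (1 - cos a)) + N * sin a * (\<integral>\<omega>. G \<omega> \<partial>M)) \<le> energy M X"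
    using main by (meson ennreal_leI order_trans)
  then show ?thesis using H by (simp add: G_def x_def a_def N_def)
qed

text \<open>Refining the grid by the factor \<open>Suc m\<close> keeps \<open>t\<close> on it, so
  the excess integral stays the same while \<open>N^2 * (1 - cos (pi / N))\<close> tends to
  \<open>pi^2 / 2\<close> and \<open>N * sin (pi / N)\<close> to \<open>pi\<close>.\<close>

lemma energy_ge_excess:
  assumes X: "permuton_process M X" and anti: "AE \<omega> in M. X 1 \<omega> = - X 0 \<omega>"
    and H: "0 < H" and k: "k \<le> 2 * H"
  defines "t \<equiv> real k / (2 * real H)"
  shows "ennreal (pi\<^sup>2 / 3 + pi * (\<integral>\<omega>. (X t \<omega> - (cos (pi * t) * X 0 \<omega> + sin (pi * t) * X (1 / 2) \<omega>))\<^sup>2 \<partial>M))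
    \<le> energy M X" (is "ennreal (_ + _ * ?G) \<le> _")
proof (rule LIMSEQ_le_const2)
  let ?N = "\<lambda>m. 2 * (real H * real (Suc m))"
  have "(\<lambda>m. 2 / 3 * ((?N m)\<^sup>2 * (1 - cos (pi / ?N m))) + ?N m * sin (pi / ?N m) * ?G) \<longlonglongrightarrow> pi\<^sup>2 / 3 + pi * ?G"
  proof -
    have Nlim: "filterlim ?N at_top sequentially" using H by real_asymp
    have "((\<lambda>y::real. y\<^sup>2 * (1 - cos (pi / y))) \<longlongrightarrow> pi\<^sup>2 / 2) at_top"
      unfolding power2_eq_square[of pi] by real_asymp
    from filterlim_compose[OF this Nlim] have c: "(\<lambda>m. (?N m)\<^sup>2 * (1 - cos (pi / ?N m))) \<longlonglongrightarrow> pi\<^sup>2 / 2" .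
    have "((\<lambda>y::real. y * sin (pi / y)) \<longlongrightarrow> pi) at_top" by real_asymp
    from filterlim_compose[OF this Nlim] have s: "(\<lambda>m. ?N m * sin (pi / ?N m)) \<longlonglongrightarrow> pi" .
    show ?thesis using tendsto_add[OF tendsto_mult_left[OF c, of "2 / 3"] tendsto_mult_right[OF s, of ?G]] by simp
  qed
  then show "(\<lambda>m. ennreal (2 / 3 * ((?N m)\<^sup>2 * (1 - cos (pi / ?N m))) + ?N m * sin (pi / ?N m) * ?G))
      \<longlonglongrightarrow> ennreal (pi\<^sup>2 / 3 + pi * ?G)"
    by (rule tendsto_ennrealI)
  have "ennreal (2 / 3 * ((?N m)\<^sup>2 * (1 - cos (pi / ?N m))) + ?N m * sin (pi / ?N m) * ?G) \<le> energy M X" for m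
  proof -
    have "real (k * Suc m) / (2 * real (H * Suc m)) = t"
    proof -
      have "real (k * Suc m) / (2 * real (H * Suc m)) = (real k * real (Suc m)) / (2 * real H * real (Suc m))"
        by (simp only: of_nat_mult mult.assoc)
      also have "\<dots> = t" unfolding t_def by (rule mult_divide_mult_cancel_right) simp
      finally show ?thesis .
    qed
    moreover have "k * Suc m \<le> 2 * (H * Suc m)" using mult_le_mono1[OF k, of "Suc m"] by (simp only: mult.assoc)
    ultimately show ?thesis
      using energy_ge_excess_mesh[OF X anti, of "H * Suc m" "k * Suc m"] H by (simp del: of_nat_Suc mult_Suc_right)
  qed
  then show "\<exists>N. \<forall>m\<ge>N. ennreal (2 / 3 * ((?N m)\<^sup>2 * (1 - cos (pi / ?N m))) + ?N m * sin (pi / ?N m) * ?G) \<le> energy M X"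
    by blast
qed

section \<open>The Archimedean process\<close>

lemma archimedean_process_eq: "archimedean_process t p = cos (pi * t) * fst p + sin (pi * t) * snd p"
  by (simp add: archimedean_process_def split_beta)

lemma AE_archimedean_measure_disk: "AE p in archimedean_measure. (fst p)\<^sup>2 + (snd p)\<^sup>2 < 1"
  unfolding archimedean_measure_def archimedean_density_def[symmetric]
  by (subst AE_density) (simp, auto simp: archimedean_density_def split: if_splits)

text \<open>Since \<open>(cos (pi * t), sin (pi * t))\<close> is a unit vector, the marginals are
  projections of the Archimedean measure, and the paths are bounded by the norm of the sampled
  point.\<close>

lemma permuton_process_archimedean: "permuton_process archimedean_measure archimedean_process"
  unfolding permuton_process_def
proof (intro conjI ballI)
  show "prob_space archimedean_measure" by (rule prob_space_archimedean_measure)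
  show "archimedean_process t \<in> borel_measurable archimedean_measure" for t
    by (simp add: archimedean_process_eq[abs_def] measurable_cong_sets[OF sets_archimedean_measure refl])
  show "distr archimedean_measure borel (archimedean_process t) = uniform_measure lborel {-1..1}" for t
    unfolding archimedean_process_eq[abs_def] by (rule distr_archimedean_projection) simp
  show "AE p in archimedean_measure. continuous_on {0..1} (\<lambda>t. archimedean_process t p) \<and>
      (\<forall>t\<in>{0..1}. archimedean_process t p \<in> {-1..1})"
    using AE_archimedean_measure_disk
  proof eventually_elim
    case (elim p)
    have "\<bar>archimedean_process t p\<bar> \<le> 1" for t
    proof -
      \<comment> \<open>Lagrange's identity: the second square is that of the projection onto the
        perpendicular direction.\<close>
      have "(archimedean_process t p)\<^sup>2 + (cos (pi * t) * snd p - sin (pi * t) * fst p)\<^sup>2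
          = ((cos (pi * t))\<^sup>2 + (sin (pi * t))\<^sup>2) * ((fst p)\<^sup>2 + (snd p)\<^sup>2)"
        unfolding archimedean_process_eq by algebra
      then have "(archimedean_process t p)\<^sup>2 + (cos (pi * t) * snd p - sin (pi * t) * fst p)\<^sup>2 = (fst p)\<^sup>2 + (snd p)\<^sup>2"
        by simp
      then have "(archimedean_process t p)\<^sup>2 \<le> (fst p)\<^sup>2 + (snd p)\<^sup>2"
        using zero_le_power2[of "cos (pi * t) * snd p - sin (pi * t) * fst p"] by linarith
      then show ?thesis using elim by (simp flip: abs_square_le_1)
    qed
    moreover have "continuous_on {0..1} (\<lambda>t. archimedean_process t p)"
      unfolding archimedean_process_eq by (intro continuous_intros)
    ultimately show ?case by (auto simp: abs_le_iff minus_le_iff)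
  qed
qed

lemma archimedean_process_antiperiodic: "archimedean_process 1 p = - archimedean_process 0 p"
  by (simp add: archimedean_process_eq)

text \<open>With half difference \<open>\<delta>\<close> and half sum \<open>\<phi>\<close> of the
  angles, the increment is \<open>2 * sin \<delta>\<close> times the projection onto the unit vector
  \<open>(- sin \<phi>, cos \<phi>)\<close>, which is uniform with second moment 1/3.\<close>

lemma archimedean_process_increment:
  "(\<integral>\<^sup>+p. ennreal (\<bar>archimedean_process t p - archimedean_process s p\<bar>\<^sup>2) \<partial>archimedean_measure)
    = ennreal (4 / 3 * (sin (pi * (t - s) / 2))\<^sup>2)"
proof -
  define \<delta> \<phi> where "\<delta> = pi * (t - s) / 2" "\<phi> = pi * (t + s) / 2"
  have t: "pi * t = \<phi> + \<delta>" and s: "pi * s = \<phi> - \<delta>"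
    by (simp_all add: \<delta>_\<phi>_def field_simps)
  have "archimedean_process t p - archimedean_process s p = 2 * sin \<delta> * (- sin \<phi> * fst p + cos \<phi> * snd p)" for p
    unfolding archimedean_process_eq t s by (simp add: cos_add cos_diff sin_add sin_diff algebra_simps)
  then have "(\<integral>\<^sup>+p. ennreal (\<bar>archimedean_process t p - archimedean_process s p\<bar>\<^sup>2) \<partial>archimedean_measure)
      = (\<integral>\<^sup>+p. ennreal ((2 * sin \<delta> * (- sin \<phi> * fst p + cos \<phi> * snd p))\<^sup>2) \<partial>archimedean_measure)"
    by simp
  also have "\<dots> = (\<integral>\<^sup>+u. ennreal ((2 * sin \<delta> * u)\<^sup>2) \<partial>uniform_measure lborel {-1..1})"
    by (rule nn_integral_archimedean_projection) auto
  also have "\<dots> = (\<integral>\<^sup>+u. ennreal (4 * (sin \<delta>)\<^sup>2) * ennreal (u\<^sup>2) \<partial>uniform_measure lborel {-1..1})"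
    by (simp add: power_mult_distrib ennreal_mult[symmetric])
  also have "\<dots> = ennreal (4 * (sin \<delta>)\<^sup>2) * ennreal (1 / 3)"
    by (subst nn_integral_cmult) (auto simp: nn_integral_square_uniform_symmetric)
  also have "\<dots> = ennreal (4 / 3 * (sin \<delta>)\<^sup>2)"
    by (subst ennreal_mult[symmetric]) auto
  finally show ?thesis by (simp add: \<delta>_\<phi>_def)
qed

text \<open>As \<open>(sin x)^2\<close> is at most \<open>x^2\<close>, every increment contributes
  at most \<open>pi^2 / 3\<close> times its duration, and the durations add up to 1.\<close>

lemma energy_archimedean_le: "energy archimedean_measure archimedean_process \<le> ennreal (pi\<^sup>2 / 3)"
  unfolding energy_def
proof (rule SUP_least, clarify)
  fix k t assume "(k, t) \<in> unit_partitions"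
  then have t: "t 0 = 0" "t k = 1" "\<And>i. i < k \<Longrightarrow> t i < t (Suc i)"
    by (auto simp: unit_partitions_def)
  have "(\<Sum>i<k. (\<integral>\<^sup>+ p. ennreal (\<bar>archimedean_process (t (Suc i)) p - archimedean_process (t i) p\<bar>\<^sup>2) \<partial>archimedean_measure)
        / ennreal (t (Suc i) - t i)) \<le> (\<Sum>i<k. ennreal (pi\<^sup>2 / 3 * (t (Suc i) - t i)))"
  proof (rule sum_mono)
    fix i assume "i \<in> {..<k}"
    then have h: "t (Suc i) - t i > 0" (is "?h > 0") using t(3) by simp
    have "(sin (pi * ?h / 2))\<^sup>2 \<le> (pi * ?h / 2)\<^sup>2"
      using abs_sin_x_le_abs_x[of "pi * ?h / 2"] by (simp only: abs_le_square_iff)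
    then have "4 / 3 * (sin (pi * ?h / 2))\<^sup>2 / ?h \<le> 4 / 3 * (pi * ?h / 2)\<^sup>2 / ?h"
      using h by (intro divide_right_mono) auto
    also have "4 / 3 * (pi * h / 2)\<^sup>2 / h = pi\<^sup>2 / 3 * h" if "h > 0" for h
      using that by (simp add: power2_eq_square)
    note this[OF h]
    finally show "(\<integral>\<^sup>+ p. ennreal (\<bar>archimedean_process (t (Suc i)) p - archimedean_process (t i) p\<bar>\<^sup>2) \<partial>archimedean_measure)
        / ennreal ?h \<le> ennreal (pi\<^sup>2 / 3 * ?h)"
      unfolding archimedean_process_increment using h by (subst divide_ennreal) (auto intro: ennreal_leI)
  qed
  also have "\<dots> = ennreal (\<Sum>i<k. pi\<^sup>2 / 3 * (t (Suc i) - t i))"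
    using t(3) by (intro sum_ennreal) (auto simp: less_imp_le)
  also have "(\<Sum>i<k. pi\<^sup>2 / 3 * (t (Suc i) - t i)) = pi\<^sup>2 / 3"
    by (subst sum_distrib_left[symmetric]) (simp add: sum_lessThan_telescope t)
  finally show "(\<Sum>i<k. (\<integral>\<^sup>+ p. ennreal (\<bar>archimedean_process (t (Suc i)) p - archimedean_process (t i) p\<bar>\<^sup>2) \<partial>archimedean_measure)
        / ennreal (t (Suc i) - t i)) \<le> ennreal (pi\<^sup>2 / 3)" .
qed

lemma energy_ge:
  assumes "permuton_process M X" and "AE \<omega> in M. X 1 \<omega> = - X 0 \<omega>"
  shows "ennreal (pi\<^sup>2 / 3) \<le> energy M X"
proof -
  \<comment> \<open>At time 0 the excess vanishes, which leaves the bare bound.\<close>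
  have "ennreal (pi\<^sup>2 / 3) \<le> ennreal (pi\<^sup>2 / 3 + pi * (\<integral>\<omega>. (X 0 \<omega> - (cos (pi * 0) * X 0 \<omega> + sin (pi * 0) * X (1 / 2) \<omega>))\<^sup>2 \<partial>M))"
    by simp
  also have "\<dots> \<le> energy M X"
    using energy_ge_excess[OF assms, of 1 0] by simp
  finally show ?thesis .
qed

lemma energy_archimedean: "energy archimedean_measure archimedean_process = ennreal (pi\<^sup>2 / 3)"
  by (intro antisym energy_archimedean_le energy_ge permuton_process_archimedean)
     (simp add: archimedean_process_antiperiodic)

section \<open>The case of equality: trigonometric paths and their law\<close>

lemma eq_trigonometric_if_energy_le_rational:
  assumes X: "permuton_process M X" and anti: "AE \<omega> in M. X 1 \<omega> = - X 0 \<omega>"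
    and le: "energy M X \<le> ennreal (pi\<^sup>2 / 3)"
    and H: "0 < H" and k: "k \<le> 2 * H"
  defines "t \<equiv> real k / (2 * real H)"
  shows "AE \<omega> in M. X t \<omega> = cos (pi * t) * X 0 \<omega> + sin (pi * t) * X (1 / 2) \<omega>"
proof -
  define Y where "Y = (\<lambda>\<omega>. X t \<omega> - (cos (pi * t) * X 0 \<omega> + sin (pi * t) * X (1 / 2) \<omega>))"
  have t: "0 \<le> t" "t \<le> 1" using H k by (auto simp: t_def)
  interpret prob_space M by (rule permuton_process_prob_space[OF X])
  have [measurable]: "X t \<in> borel_measurable M" "X 0 \<in> borel_measurable M" "X (1 / 2) \<in> borel_measurable M"
    using t by (auto intro: permuton_process_measurable[OF X])
  \<comment> \<open>The lower bound with excess and the assumed upper bound leave no room for a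
    positive excess integral.\<close>
  have "ennreal (pi\<^sup>2 / 3 + pi * (\<integral>\<omega>. (Y \<omega>)\<^sup>2 \<partial>M)) \<le> ennreal (pi\<^sup>2 / 3)"
    using energy_ge_excess[OF X anti H k] le unfolding Y_def t_def by (rule order_trans)
  then have "pi\<^sup>2 / 3 + pi * (\<integral>\<omega>. (Y \<omega>)\<^sup>2 \<partial>M) \<le> pi\<^sup>2 / 3"
    by (subst (asm) ennreal_le_iff) auto
  then have "(\<integral>\<omega>. (Y \<omega>)\<^sup>2 \<partial>M) \<le> 0" using pi_gt_zero by (auto simp: mult_le_0_iff)
  moreover have "(\<integral>\<omega>. (Y \<omega>)\<^sup>2 \<partial>M) \<ge> 0" by simp
  ultimately have z: "(\<integral>\<omega>. (Y \<omega>)\<^sup>2 \<partial>M) = 0" by linarith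
  \<comment> \<open>A Bochner integral is 0 by default when the function is not integrable, so
    integrability has to be shown before \<open>z\<close> can give \<open>Y = 0\<close> almost
    everywhere. The three terms of \<open>Y\<close> have modulus at most 1, hence the bound
    9.\<close>
  have "AE \<omega> in M. norm ((Y \<omega>)\<^sup>2) \<le> 9"
    using permuton_process_bounded[OF X t] permuton_process_bounded[OF X, of 0, simplified]
      permuton_process_bounded[OF X, of "1 / 2", simplified]
  proof (eventually_elim, simp_all)
    fix \<omega> assume b: "\<bar>X t \<omega>\<bar> \<le> 1" "\<bar>X 0 \<omega>\<bar> \<le> 1" "\<bar>X (1 / 2) \<omega>\<bar> \<le> 1"
    have "\<bar>cos (pi * t) * X 0 \<omega>\<bar> \<le> 1" "\<bar>sin (pi * t) * X (1 / 2) \<omega>\<bar> \<le> 1"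
      using b by (auto simp: abs_mult mult_le_one)
    then have "\<bar>Y \<omega>\<bar> \<le> \<bar>3\<bar>" using b(1) unfolding Y_def by linarith
    then show "(Y \<omega>)\<^sup>2 \<le> 9" by (subst (asm) abs_le_square_iff) simp
  qed
  then have "integrable M (\<lambda>\<omega>. (Y \<omega>)\<^sup>2)"
    by (intro integrable_const_bound) (auto simp: Y_def)
  from integral_nonneg_eq_0_iff_AE[OF this] z have "AE \<omega> in M. (Y \<omega>)\<^sup>2 = 0" by simp
  then show ?thesis by (auto simp: Y_def)
qed

text \<open>The fractions with even denominator are dense: \<open>t\<close> is the limit of the
  largest multiples of \<open>1 / (2 * Suc n)\<close> not exceeding it. Even denominators belong to
  the grids that contain 1/2.\<close>

lemma continuous_on_unit_interval_eq_0I: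
  fixes f :: "real \<Rightarrow> real"
  assumes f: "continuous_on {0..1} f"
    and z: "\<And>k H. 0 < H \<Longrightarrow> k \<le> 2 * H \<Longrightarrow> f (real k / (2 * real H)) = 0"
    and t: "t \<in> {0..1}"
  shows "f t = 0"
proof -
  define k where "k = (\<lambda>n. nat \<lfloor>t * (2 * real (Suc n))\<rfloor>)"
  define s where "s = (\<lambda>n. real (k n) / (2 * real (Suc n)))"
  have kr: "real (k n) = of_int \<lfloor>t * (2 * real (Suc n))\<rfloor>" for n using t by (simp add: k_def)
  have up: "s n \<le> t" for n
    unfolding s_def kr by (subst divide_le_eq) (auto simp del: of_nat_Suc)
  have low: "t - 1 / real (Suc n) \<le> s n" for n
  proof -
    \<comment> \<open>Allowing 2 instead of the 1 lost by the floor makes the error bound exactly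
      \<open>1 / Suc n\<close>.\<close>
    have "t * (2 * real (Suc n)) - 2 \<le> real (k n)" unfolding kr by linarith
    then have "(t * (2 * real (Suc n)) - 2) / (2 * real (Suc n)) \<le> s n"
      unfolding s_def by (rule divide_right_mono) simp
    then show ?thesis by (simp add: diff_divide_distrib del: of_nat_Suc)
  qed
  have kn: "k n \<le> 2 * Suc n" for n
  proof -
    have "t * (2 * real (Suc n)) \<le> 1 * (2 * real (Suc n))" using t by (intro mult_right_mono) auto
    then have "real (k n) \<le> 2 * real (Suc n)" unfolding kr by linarith
    then show ?thesis by linarith
  qed
  have "s \<longlonglongrightarrow> t"
  proof (rule tendsto_sandwich)
    show "(\<lambda>n. t - 1 / real (Suc n)) \<longlonglongrightarrow> t"
      using tendsto_diff[OF tendsto_const[of t] LIMSEQ_inverse_real_of_nat] by (simp add: inverse_eq_divide)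
  qed (use up low in auto)
  moreover have "s n \<in> {0..1}" for n
  proof -
    have "0 \<le> s n" by (simp add: s_def)
    then show ?thesis using up[of n] t by auto
  qed
  ultimately have "(\<lambda>n. f (s n)) \<longlonglongrightarrow> f t"
    using f t by (intro continuous_on_tendsto_compose[OF f]) auto
  moreover have "f (s n) = 0" for n unfolding s_def using kn[of n] by (intro z) auto
  ultimately show ?thesis by (simp add: LIMSEQ_const_iff)
qed

text \<open>The exceptional null sets of the countably many grid times have a null union; off it,
  and for continuous paths, the identity extends from the grid times to all times.\<close>

lemma eq_trigonometric_if_energy_le:
  assumes X: "permuton_process M X" and anti: "AE \<omega> in M. X 1 \<omega> = - X 0 \<omega>"
    and le: "energy M X \<le> ennreal (pi\<^sup>2 / 3)"
  shows "AE \<omega> in M. \<forall>t\<in>{0..1}. X t \<omega> = cos (pi * t) * X 0 \<omega> + sin (pi * t) * X (1 / 2) \<omega>"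
proof -
  have "AE \<omega> in M. \<forall>H k. 0 < H \<longrightarrow> k \<le> 2 * H \<longrightarrow> X (real k / (2 * real H)) \<omega>
      = cos (pi * (real k / (2 * real H))) * X 0 \<omega> + sin (pi * (real k / (2 * real H))) * X (1 / 2) \<omega>"
    unfolding AE_all_countable
    using eq_trigonometric_if_energy_le_rational[OF X anti le] by (simp add: AE_impI)
  moreover have "AE \<omega> in M. continuous_on {0..1} (\<lambda>t. X t \<omega>) \<and> (\<forall>t\<in>{0..1}. X t \<omega> \<in> {-1..1})"
    using X by (simp add: permuton_process_def)
  ultimately show ?thesis
  proof eventually_elim
    case (elim \<omega>)
    have c: "continuous_on {0..1} (\<lambda>t. X t \<omega> - (cos (pi * t) * X 0 \<omega> + sin (pi * t) * X (1 / 2) \<omega>))"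
      using elim(2) by (intro continuous_intros) simp
    show ?case
    proof
      fix t :: real assume t: "t \<in> {0..1}"
      have "X t \<omega> - (cos (pi * t) * X 0 \<omega> + sin (pi * t) * X (1 / 2) \<omega>) = 0"
      proof (rule continuous_on_unit_interval_eq_0I[OF c _ t])
        fix k H :: nat assume "0 < H" "k \<le> 2 * H"
        then show "X (real k / (2 * real H)) \<omega> - (cos (pi * (real k / (2 * real H))) * X 0 \<omega>
            + sin (pi * (real k / (2 * real H))) * X (1 / 2) \<omega>) = 0"
          unfolding right_minus_eq using elim(1) by blast
      qed
      then show "X t \<omega> = cos (pi * t) * X 0 \<omega> + sin (pi * t) * X (1 / 2) \<omega>"
        by (simp only: right_minus_eq)
    qed
  qed
qed

text \<open>Letting \<open>r\<close> be negative restricts the angle to \<open>[0, pi]\<close>,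
  hence \<open>t\<close> to the time interval of a permuton process. Points below the horizontal
  axis are reflected through the origin.\<close>

lemma polar_half_plane:
  obtains r t :: real where "t \<in> {0..1}" and "x = r * cos (pi * t)" and "y = r * sin (pi * t)"
proof -
  have pos: "\<exists>r t. t \<in> {0..1} \<and> x = r * cos (pi * t) \<and> y = r * sin (pi * t)" if y: "y \<ge> 0" for x y :: real
  proof (cases "x = 0 \<and> y = 0")
    case True
    then show ?thesis by (intro exI[of _ 0]) auto
  next
    case False
    define r where "r = sqrt (x\<^sup>2 + y\<^sup>2)"
    have r: "r > 0" "r\<^sup>2 = x\<^sup>2 + y\<^sup>2" using False by (auto simp: r_def sum_power2_gt_zero_iff)
    have "(x / r)\<^sup>2 + (y / r)\<^sup>2 = 1"
      using r(1) by (simp add: power_divide add_divide_distrib[symmetric] r(2)[symmetric])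
    then obtain \<theta> where \<theta>: "0 \<le> \<theta>" "\<theta> \<le> pi" "x / r = cos \<theta>" "y / r = sin \<theta>"
      using sincos_total_pi[of "y / r" "x / r"] y r by auto
    show ?thesis
    proof (intro exI conjI)
      show "\<theta> / pi \<in> {0..1}" using \<theta> by auto
      show "x = r * cos (pi * (\<theta> / pi))" "y = r * sin (pi * (\<theta> / pi))"
        using \<theta> r by (auto simp: field_simps)
    qed
  qed
  show ?thesis
  proof (cases "y \<ge> 0")
    case True
    then show ?thesis using pos that by blast
  next
    case False
    then obtain r t where "t \<in> {0..1}" "- x = r * cos (pi * t)" "- y = r * sin (pi * t)"
      using pos[of "- y" "- x"] by auto
    then show ?thesis by (intro that[of t "- r"]) auto
  qed
qed

text \<open>By polar coordinates every linear functional of \<open>(X 0, X (1 / 2))\<close> is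
  almost surely a multiple \<open>r * X t\<close> with \<open>t\<close> in \<open>{0..1}\<close>.
  Its law is that of a scaled uniform variable, which is also the law of the same functional under
  the Archimedean measure. Both measures are carried by the square \<open>[-1, 1]^2\<close>, so
  equal cosine integrals identify them.\<close>

lemma distr_trigonometric_permuton:
  assumes X: "permuton_process M X"
    and trig: "AE \<omega> in M. \<forall>t\<in>{0..1}. X t \<omega> = cos (pi * t) * X 0 \<omega> + sin (pi * t) * X (1 / 2) \<omega>"
  shows "distr M borel (\<lambda>\<omega>. (X 0 \<omega>, X (1 / 2) \<omega>)) = archimedean_measure" (is "?L = _")
proof (rule measure_eq_if_cosine_integrals_eq)
  interpret prob_space M by (rule permuton_process_prob_space[OF X])
  have meas: "X t \<in> borel_measurable M" if "t \<in> {0..1}" for t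
    using that by (auto intro: permuton_process_measurable[OF X])
  have [measurable]: "X 0 \<in> borel_measurable M" "X (1 / 2) \<in> borel_measurable M"
    by (auto intro: meas)
  have Z [measurable]: "(\<lambda>\<omega>. (X 0 \<omega>, X (1 / 2) \<omega>)) \<in> M \<rightarrow>\<^sub>M borel"
    by (simp add: borel_prod[symmetric])
  show "prob_space ?L" by (rule prob_space_distr) (rule Z)
  show "compact (cbox (-1, -1) (1, 1) :: (real \<times> real) set)" by (rule compact_cbox)
  have b0: "AE \<omega> in M. \<bar>X 0 \<omega>\<bar> \<le> 1" and b1: "AE \<omega> in M. \<bar>X (1 / 2) \<omega>\<bar> \<le> 1"
    by (auto intro: permuton_process_bounded[OF X])
  show "AE p in ?L. p \<in> cbox (-1, -1) (1, 1)"
  proof (subst AE_distr_iff[OF Z])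
    show "AE \<omega> in M. (X 0 \<omega>, X (1 / 2) \<omega>) \<in> cbox (-1, -1) (1, 1)"
      using b0 b1 by eventually_elim (auto simp: abs_le_iff)
  qed auto
  show "AE p in archimedean_measure. p \<in> cbox (-1, -1) (1, 1)"
    using AE_archimedean_measure_disk
  proof eventually_elim
    case (elim p)
    then have "(fst p)\<^sup>2 \<le> 1" "(snd p)\<^sup>2 \<le> 1" by (smt (verit) zero_le_power2)+
    then show ?case by (cases p) (auto simp: abs_square_le_1 abs_le_iff)
  qed
  fix a :: "real \<times> real" and c :: real
  obtain r t where t: "t \<in> {0..1}" and a: "fst a = r * cos (pi * t)" "snd a = r * sin (pi * t)"
    by (rule polar_half_plane)
  have inner: "a \<bullet> p = r * (cos (pi * t) * fst p + sin (pi * t) * snd p)" for p :: "real \<times> real"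
    by (cases p, cases a) (use a in \<open>simp add: algebra_simps\<close>)
  note [measurable] = meas[OF t]
  have "(\<integral>p. cos (a \<bullet> p + c) \<partial>?L) = (\<integral>\<omega>. cos (a \<bullet> (X 0 \<omega>, X (1 / 2) \<omega>) + c) \<partial>M)"
    by (rule integral_distr[OF Z]) (intro borel_measurable_continuous_onI continuous_intros)
  also have "\<dots> = (\<integral>\<omega>. cos (r * X t \<omega> + c) \<partial>M)"
  proof (rule integral_cong_AE)
    show "AE \<omega> in M. cos (a \<bullet> (X 0 \<omega>, X (1 / 2) \<omega>) + c) = cos (r * X t \<omega> + c)"
      using trig
    proof eventually_elim
      case (elim \<omega>)
      then have "X t \<omega> = cos (pi * t) * X 0 \<omega> + sin (pi * t) * X (1 / 2) \<omega>" using t by blast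
      then show ?case by (simp only: inner fst_conv snd_conv)
    qed
    show "(\<lambda>\<omega>. cos (a \<bullet> (X 0 \<omega>, X (1 / 2) \<omega>) + c)) \<in> borel_measurable M"
      unfolding inner fst_conv snd_conv by measurable
  qed measurable
  also have "\<dots> = (\<integral>u. cos (r * u + c) \<partial>distr M borel (X t))"
    by (rule integral_distr[symmetric]) auto
  also have "distr M borel (X t) = distr archimedean_measure borel (\<lambda>p. cos (pi * t) * fst p + sin (pi * t) * snd p)"
    using X t by (simp add: permuton_process_def distr_archimedean_projection)
  also have "(\<integral>u. cos (r * u + c) \<partial>\<dots>) = (\<integral>p. cos (r * (cos (pi * t) * fst p + sin (pi * t) * snd p) + c) \<partial>archimedean_measure)"
    by (rule integral_distr) (auto simp: measurable_cong_sets[OF sets_archimedean_measure refl])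
  finally show "(\<integral>p. cos (a \<bullet> p + c) \<partial>?L) = (\<integral>p. cos (a \<bullet> p + c) \<partial>archimedean_measure)"
    by (simp add: inner)
qed (auto simp: prob_space_archimedean_measure)

text \<open>Almost every path is the image of \<open>(X 0, X (1 / 2))\<close> under the map that
  sends a point of the plane to its Archimedean path, so the law of this vector pushes forward to
  the law of the process.\<close>

lemma process_law_eq_archimedean_if_trigonometric:
  assumes X: "permuton_process M X"
    and trig: "AE \<omega> in M. \<forall>t\<in>{0..1}. X t \<omega> = cos (pi * t) * X 0 \<omega> + sin (pi * t) * X (1 / 2) \<omega>"
  shows "process_law M X = process_law archimedean_measure archimedean_process"
proof -
  let ?\<Phi> = "\<lambda>p. \<lambda>t\<in>{0..1}. archimedean_process t p"
  let ?Z = "\<lambda>\<omega>. (X 0 \<omega>, X (1 / 2) \<omega>)"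
  have meas: "X t \<in> borel_measurable M" if "t \<in> {0..1}" for t
    using that by (auto intro: permuton_process_measurable[OF X])
  have [measurable]: "X 0 \<in> borel_measurable M" "X (1 / 2) \<in> borel_measurable M"
    by (auto intro: meas)
  have Z [measurable]: "?Z \<in> M \<rightarrow>\<^sub>M borel"
    by (simp add: borel_prod[symmetric])
  have \<Phi> [measurable]: "?\<Phi> \<in> borel \<rightarrow>\<^sub>M (\<Pi>\<^sub>M t\<in>{0..1}. borel)"
    by (intro measurable_restrict) (simp add: archimedean_process_eq[abs_def])
  have "process_law M X = distr M (\<Pi>\<^sub>M t\<in>{0..1}. borel) (?\<Phi> \<circ> ?Z)"
    unfolding process_law_def
  proof (rule distr_cong_AE)
    show "AE \<omega> in M. (\<lambda>t\<in>{0..1}. X t \<omega>) = (?\<Phi> \<circ> ?Z) \<omega>"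
      using trig
    proof eventually_elim
      case (elim \<omega>)
      then show ?case
        unfolding comp_def archimedean_process_eq fst_conv snd_conv by (intro restrict_ext) blast
    qed
    show "(\<lambda>\<omega>. \<lambda>t\<in>{0..1}. X t \<omega>) \<in> M \<rightarrow>\<^sub>M (\<Pi>\<^sub>M t\<in>{0..1}. borel)"
      by (intro measurable_restrict meas)
    show "?\<Phi> \<circ> ?Z \<in> M \<rightarrow>\<^sub>M (\<Pi>\<^sub>M t\<in>{0..1}. borel)"
      by (rule measurable_comp[OF Z \<Phi>])
  qed auto
  also have "\<dots> = distr (distr M borel ?Z) (\<Pi>\<^sub>M t\<in>{0..1}. borel) ?\<Phi>"
    by (rule distr_distr[OF \<Phi> Z, symmetric])
  also have "\<dots> = process_law archimedean_measure archimedean_process"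
    unfolding distr_trigonometric_permuton[OF assms] process_law_def ..
  finally show ?thesis .
qed

section \<open>Dependence of the energy on the law only\<close>

lemma unit_partitions_range:
  assumes "(k, t) \<in> unit_partitions" and "i \<le> k"
  shows "t i \<in> {0..1}"
proof -
  have t: "t 0 = 0" "t k = 1" "\<And>i. i < k \<Longrightarrow> t i < t (Suc i)"
    using assms(1) by (auto simp: unit_partitions_def)
  have mono: "t i \<le> t j" if "i \<le> j" "j \<le> k" for i j
    using that
  proof (induction j rule: dec_induct)
    case (step j)
    then show ?case using t(3)[of j] by simp
  qed simp
  show ?thesis using mono[of 0 i] mono[of i k] assms(2) t by auto
qed

text \<open>A squared increment is a measurable function of two coordinates of the path. Both times
  lie in \<open>{0..1}\<close> because the law records no other coordinates.\<close>

lemma nn_integral_increment_process_law: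
  assumes X: "\<And>t. t \<in> {0..1} \<Longrightarrow> X t \<in> borel_measurable M" and st: "s \<in> {0..1}" "t \<in> {0..1}"
  shows "(\<integral>\<^sup>+\<omega>. ennreal (\<bar>X t \<omega> - X s \<omega>\<bar>\<^sup>2) \<partial>M) = (\<integral>\<^sup>+f. ennreal (\<bar>f t - f s\<bar>\<^sup>2) \<partial>process_law M X)"
proof -
  have "(\<lambda>\<omega>. \<lambda>t\<in>{0..1}. X t \<omega>) \<in> M \<rightarrow>\<^sub>M (\<Pi>\<^sub>M t\<in>{0..1}. borel)"
    by (intro measurable_restrict X)
  moreover have "(\<lambda>f. ennreal (\<bar>f t - f s\<bar>\<^sup>2)) \<in> borel_measurable (\<Pi>\<^sub>M t\<in>{0..1::real}. (borel :: real measure))"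
    using st by measurable
  ultimately show ?thesis
    unfolding process_law_def using st by (subst nn_integral_distr) auto
qed

text \<open>This serves the converse half of the equality statement: partition points stay in
  \<open>{0..1}\<close>, so every summand of the energy is an integral against the law.\<close>

lemma energy_eq_if_process_law_eq:
  assumes X: "\<And>t. t \<in> {0..1} \<Longrightarrow> X t \<in> borel_measurable M"
    and Y: "\<And>t. t \<in> {0..1} \<Longrightarrow> Y t \<in> borel_measurable N"
    and law: "process_law M X = process_law N Y"
  shows "energy M X = energy N Y"
proof -
  show ?thesis
    unfolding energy_def
  proof (intro SUP_cong refl, clarify)
    fix k t assume kt: "(k, t) \<in> unit_partitions"
    show "(\<Sum>i<k. (\<integral>\<^sup>+ \<omega>. ennreal (\<bar>X (t (Suc i)) \<omega> - X (t i) \<omega>\<bar>\<^sup>2) \<partial>M) / ennreal (t (Suc i) - t i))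
        = (\<Sum>i<k. (\<integral>\<^sup>+ \<omega>. ennreal (\<bar>Y (t (Suc i)) \<omega> - Y (t i) \<omega>\<bar>\<^sup>2) \<partial>N) / ennreal (t (Suc i) - t i))"
    proof (intro sum.cong refl)
      fix i assume "i \<in> {..<k}"
      then have r: "t i \<in> {0..1}" "t (Suc i) \<in> {0..1}" by (auto intro!: unit_partitions_range[OF kt] simp del: atLeastAtMost_iff)
      have "(\<integral>\<^sup>+ \<omega>. ennreal (\<bar>X (t (Suc i)) \<omega> - X (t i) \<omega>\<bar>\<^sup>2) \<partial>M)
          = (\<integral>\<^sup>+f. ennreal (\<bar>f (t (Suc i)) - f (t i)\<bar>\<^sup>2) \<partial>process_law M X)"
        by (rule nn_integral_increment_process_law[OF _ r]) (rule X)
      moreover have "(\<integral>\<^sup>+ \<omega>. ennreal (\<bar>Y (t (Suc i)) \<omega> - Y (t i) \<omega>\<bar>\<^sup>2) \<partial>N)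
          = (\<integral>\<^sup>+f. ennreal (\<bar>f (t (Suc i)) - f (t i)\<bar>\<^sup>2) \<partial>process_law N Y)"
        by (rule nn_integral_increment_process_law[OF _ r]) (rule Y)
      ultimately show "(\<integral>\<^sup>+ \<omega>. ennreal (\<bar>X (t (Suc i)) \<omega> - X (t i) \<omega>\<bar>\<^sup>2) \<partial>M) / ennreal (t (Suc i) - t i)
        = (\<integral>\<^sup>+ \<omega>. ennreal (\<bar>Y (t (Suc i)) \<omega> - Y (t i) \<omega>\<bar>\<^sup>2) \<partial>N) / ennreal (t (Suc i) - t i)"
        by (simp only: law)
    qed
  qed
qed

theorem theorem2:
  shows "permuton_process archimedean_measure archimedean_process \<and>
    (AE p in archimedean_measure. archimedean_process 1 p = - archimedean_process 0 p) \<and>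
    (\<forall>(M :: 'a measure) (X :: real \<Rightarrow> 'a \<Rightarrow> real).
       permuton_process M X \<and> (AE \<omega> in M. X 1 \<omega> = - X 0 \<omega>) \<longrightarrow>
         energy M X \<ge> energy archimedean_measure archimedean_process \<and>
         (energy M X = energy archimedean_measure archimedean_process \<longleftrightarrow>
            process_law M X = process_law archimedean_measure archimedean_process))"
proof (intro conjI allI impI)
  show "permuton_process archimedean_measure archimedean_process"
    by (rule permuton_process_archimedean)
  show "AE p in archimedean_measure. archimedean_process 1 p = - archimedean_process 0 p"
    by (simp add: archimedean_process_antiperiodic)
  fix M :: "'a measure" and X :: "real \<Rightarrow> 'a \<Rightarrow> real"
  assume "permuton_process M X \<and> (AE \<omega> in M. X 1 \<omega> = - X 0 \<omega>)"
  then have X: "permuton_process M X" and anti: "AE \<omega> in M. X 1 \<omega> = - X 0 \<omega>" by auto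
  show "energy archimedean_measure archimedean_process \<le> energy M X"
    unfolding energy_archimedean by (rule energy_ge[OF X anti])
  show "energy M X = energy archimedean_measure archimedean_process \<longleftrightarrow>
      process_law M X = process_law archimedean_measure archimedean_process"
  proof
    assume "energy M X = energy archimedean_measure archimedean_process"
    then have "energy M X \<le> ennreal (pi\<^sup>2 / 3)" by (simp add: energy_archimedean)
    then show "process_law M X = process_law archimedean_measure archimedean_process"
      by (intro process_law_eq_archimedean_if_trigonometric[OF X] eq_trigonometric_if_energy_le[OF X anti])
  next
    assume "process_law M X = process_law archimedean_measure archimedean_process"
    then show "energy M X = energy archimedean_measure archimedean_process"
      using X permuton_process_archimedean
      by (intro energy_eq_if_process_law_eq) (auto simp: permuton_process_def)
  qed
qed

end
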